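(* Let $n\geq 19$ with $n\equiv 3\pmod 4$, let $r$ be even with $8\leq r<(n-3)/2$, and put $L=n-2r-2$. Let $V$ consist of the $n$ distinct vertices $p_1,p_2,p_3,q_0=p_4,q_1,\dots,q_L,y_3,\dots,y_{r+1},z_3,\dots,z_{r+1}$, and write $y_2:=q_L$. Consider the labelled graph on $V$ with edges: $\{p_1,p_2\}$ with label $0$; $\{p_2,p_3\}$ with label $1$; $\{p_3,p_4\}$ with the two labels $0$ and $2$; $\{q_{s-1},q_s\}$ for $1\leq s\leq L$ with label $1$ if $s$ is odd and $0$ if $s$ is even; $\{y_k,y_{k+1}\}$ with label $k$ for $2\leq k\leq r-1$; $\{y_r,y_{r+1}\}$ with label $r-2$; $\{z_k,z_{k+1}\}$ with label $k$ for $3\leq k\leq r-1$; $\{z_r,z_{r+1}\}$ with label $r-2$; and $\{y_j,z_j\}$ with label $r-4$ for $j\in\{r-2,r-1,r,r+1\}$. Then $G\cong A_n$ and $(G,(\rho_0,\dots,\rho_{r-1}))$ is a string C-group of rank $r$ with Schläfli type $\{n-2(r-1),12,6,3^{r-8},6,6,6,4\}$.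
   Context: A string group generated by involutions (sggi) of rank $r$ is a pair $(G,(\rho_0,\dots,\rho_{r-1}))$ where $\rho_0,\dots,\rho_{r-1}$ are involutions generating the group $G$ such that $(\rho_i\rho_j)^2=1$ whenever $|i-j|\geq 2$. It is a string C-group if in addition it satisfies the intersection property: for all $J,K\subseteq\{0,\dots,r-1\}$, $\langle \rho_j : j\in J\rangle\cap\langle\rho_k : k\in K\rangle=\langle \rho_j : j\in J\cap K\rangle$. The Schläfli type is $\{p_1,\dots,p_{r-1}\}$ where $p_i$ is the order of $\rho_{i-1}\rho_i$; $3^k$ denotes $k$ consecutive entries equal to $3$ (omitted if $k=0$). Labelled-graph convention: the vertex set $V$ is finite, and each edge $\{a,b\}$ ($a\neq b$) carries one or more labels from $\{0,\dots,r-1\}$, the edges carrying any given label being pairwise disjoint; $\rho_k$ denotes the permutation of $V$ equal to the product of the transpositions $(a\,b)$ over all edges $\{a,b\}$ carrying label $k$, and $G=\langle\rho_0,\dots,\rho_{r-1}\rangle\leq \mathrm{Sym}(V)$. *)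

theory Defs
  imports "HOL-Algebra.Algebra"
begin

text \<open>A labelled graph is given as a set E of pairs (edge, label), an edge being a
two-element set of vertices. rho_k is the product of the transpositions (a b) over the
edges {a,b} carrying label k (the edges with a given label being pairwise disjoint).\<close>

definition lgraph_perm :: "(nat set \<times> nat) set \<Rightarrow> nat \<Rightarrow> nat \<Rightarrow> nat" where
  "lgraph_perm E k x =
     (if \<exists>y. y \<noteq> x \<and> ({x, y}, k) \<in> E then (THE y. y \<noteq> x \<and> ({x, y}, k) \<in> E) else x)"

definition sggi :: "('a, 'b) monoid_scheme \<Rightarrow> nat \<Rightarrow> (nat \<Rightarrow> 'a) \<Rightarrow> bool" where
  "sggi G r \<rho> \<longleftrightarrow> group G
     \<and> (\<forall>i<r. \<rho> i \<in> carrier G \<and> \<rho> i \<noteq> \<one>\<^bsub>G\<^esub> \<and> \<rho> i \<otimes>\<^bsub>G\<^esub> \<rho> i = \<one>\<^bsub>G\<^esub>)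
     \<and> generate G (\<rho> ` {..<r}) = carrier G
     \<and> (\<forall>i<r. \<forall>j<r. (i + 2 \<le> j \<or> j + 2 \<le> i) \<longrightarrow>
            (\<rho> i \<otimes>\<^bsub>G\<^esub> \<rho> j) [^]\<^bsub>G\<^esub> (2::nat) = \<one>\<^bsub>G\<^esub>)"

definition intersection_property :: "('a, 'b) monoid_scheme \<Rightarrow> nat \<Rightarrow> (nat \<Rightarrow> 'a) \<Rightarrow> bool" where
  "intersection_property G r \<rho> \<longleftrightarrow>
     (\<forall>J K. J \<subseteq> {..<r} \<longrightarrow> K \<subseteq> {..<r} \<longrightarrow>
        generate G (\<rho> ` J) \<inter> generate G (\<rho> ` K) = generate G (\<rho> ` (J \<inter> K)))"

definition string_C_group :: "('a, 'b) monoid_scheme \<Rightarrow> nat \<Rightarrow> (nat \<Rightarrow> 'a) \<Rightarrow> bool" where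
  "string_C_group G r \<rho> \<longleftrightarrow> sggi G r \<rho> \<and> intersection_property G r \<rho>"

definition schlafli_type :: "('a, 'b) monoid_scheme \<Rightarrow> nat \<Rightarrow> (nat \<Rightarrow> 'a) \<Rightarrow> nat list" where
  "schlafli_type G r \<rho> = map (\<lambda>i. group.ord G (\<rho> i \<otimes>\<^bsub>G\<^esub> \<rho> (Suc i))) [0..<r - 1]"

text \<open>Vertex encoding in {1..n} with L = n - 2r - 2:
  p1 = 1, p2 = 2, p3 = 3, q_s = 4 + s (0 \<le> s \<le> L, so q_0 = p4 = 4),
  y_j = L + 2 + j (3 \<le> j \<le> r+1; also y_2 = L + 4 = q_L),
  z_j = L + r + 1 + j (3 \<le> j \<le> r+1).\<close>

definition thm410_L :: "nat \<Rightarrow> nat \<Rightarrow> nat" where "thm410_L n r = n - 2 * r - 2"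
definition thm410_q :: "nat \<Rightarrow> nat \<Rightarrow> nat \<Rightarrow> nat" where "thm410_q n r s = 4 + s"
definition thm410_y :: "nat \<Rightarrow> nat \<Rightarrow> nat \<Rightarrow> nat" where "thm410_y n r j = thm410_L n r + 2 + j"
definition thm410_z :: "nat \<Rightarrow> nat \<Rightarrow> nat \<Rightarrow> nat" where "thm410_z n r j = thm410_L n r + r + 1 + j"

definition thm410_edges :: "nat \<Rightarrow> nat \<Rightarrow> (nat set \<times> nat) set" where
  "thm410_edges n r =
     {({1, 2}, 0), ({2, 3}, 1), ({3, 4}, 0), ({3, 4}, 2)}
   \<union> {({thm410_q n r (s - 1), thm410_q n r s}, if odd s then 1 else 0) | s. 1 \<le> s \<and> s \<le> thm410_L n r}
   \<union> {({thm410_y n r k, thm410_y n r (k + 1)}, k) | k. 2 \<le> k \<and> k \<le> r - 1}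
   \<union> {({thm410_y n r r, thm410_y n r (r + 1)}, r - 2)}
   \<union> {({thm410_z n r k, thm410_z n r (k + 1)}, k) | k. 3 \<le> k \<and> k \<le> r - 1}
   \<union> {({thm410_z n r r, thm410_z n r (r + 1)}, r - 2)}
   \<union> {({thm410_y n r j, thm410_z n r j}, r - 4) | j. j \<in> {r - 2, r - 1, r, r + 1}}"

definition thm410_rho :: "nat \<Rightarrow> nat \<Rightarrow> nat \<Rightarrow> nat \<Rightarrow> nat" where
  "thm410_rho n r k = lgraph_perm (thm410_edges n r) k"

definition thm410_G :: "nat \<Rightarrow> nat \<Rightarrow> (nat \<Rightarrow> nat) monoid" where
  "thm410_G n r = (sym_group n)\<lparr>carrier := generate (sym_group n) (thm410_rho n r ` {..<r})\<rparr>"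

end

theory Submission
  imports Defs
begin

text \<open>By induction on the largest index, the intersection property reduces to
  \<open>\<langle>\<rho>\<^sub>0,\<dots>,\<rho>\<^sub>j\<rangle> \<inter> \<langle>\<rho>\<^sub>i,\<dots>,\<rho>\<^sub>r\<^sub>-\<^sub>1\<rangle> \<subseteq> \<langle>\<rho>\<^sub>i,\<dots>,\<rho>\<^sub>j\<rangle>\<close> for all i and j.

  The vertices p_1, ..., y_2 form a path with an odd number of vertices, on which \<open>\<rho>\<^sub>0\<close> and \<open>\<rho>\<^sub>1\<close> generate a dihedral group;
  this settles j at most 1. For i = 1, 2 an element of the intersection can be multiplied by elements of
  \<open>\<langle>\<rho>\<^sub>i,\<dots>,\<rho>\<^sub>j\<rangle>\<close> until it only moves the end of the path and the part of the tails that is connected to it. It is then an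
  even permutation of this set, and the group on the right contains the whole alternating group of the set, because it contains
  the 3-cycle \<open>(\<rho>\<^sub>2\<rho>\<^sub>3)\<^sup>2\<close>, or \<open>(\<rho>\<^sub>1\<rho>\<^sub>2)\<^sup>4\<close> for i = 1 and j = 2, whose support can be enlarged one point at a time. The
  same argument with all generators shows that G is the alternating group.

  For i at least 3 the group \<open>\<langle>\<rho>\<^sub>i,\<dots>,\<rho>\<^sub>r\<^sub>-\<^sub>1\<rangle>\<close> consists of signed permutations of the tail indices, a sign standing for an
  exchange of y_j and z_j, and both sides of the inclusion can be described explicitly.\<close>

text \<open>The congruences on n and r give \<open>M mod 4 = 1\<close>, so
  \<open>\<rho>\<^sub>0\<close> and \<open>\<rho>\<^sub>1\<close> consist of an even number (M -
  1)/2 of transpositions and every generator is even. This bounds the group from above, and it also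
  decides intersections: for i at most 2, and for i from 3 up to r - 5, what survives the reductions
  could miss the smaller group only by an odd permutation such as the exchange of y_2 and y_3 or of
  one pair y_j, z_j. The obstacle on the tails is that two generators are not plain adjacent
  transpositions of indices: \<open>\<rho>\<^sub>r\<^sub>-\<^sub>4\<close> also exchanges the sides
  of four indices, and \<open>\<rho>\<^sub>r\<^sub>-\<^sub>2\<close> has a second transposition. If
  the preceding generator is available, the cube of the product with it splits the extra factor off.
  If it is missing, the extra factor is tied to the rest. This is why i = r - 4, where the index
  permutation determines the signs up to a global one, and i = r - 2, where a dihedral group acts on
  four indices, need arguments of their own.\<close>

section \<open>Groups generated by involutive functions\<close>

text \<open>Words grow by left multiplication only and there is no rule for inverses: for an
  involutive \<open>S\<close> the set is closed under them (\<open>gp_inverse\<close>), so it is the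
  generated group and inductions have just two cases.\<close>

inductive_set gp :: "('a \<Rightarrow> 'a) set \<Rightarrow> ('a \<Rightarrow> 'a) set" for S where
  gp_id: "id \<in> gp S"
| gp_step: "s \<in> S \<Longrightarrow> g \<in> gp S \<Longrightarrow> s \<circ> g \<in> gp S"

definition involutive :: "('a \<Rightarrow> 'a) set \<Rightarrow> bool" where
  "involutive S \<longleftrightarrow> (\<forall>s\<in>S. s \<circ> s = id)"

lemma involutive_subset: "involutive S \<Longrightarrow> T \<subseteq> S \<Longrightarrow> involutive T"
  unfolding involutive_def by blast

lemma gp_gen: "s \<in> S \<Longrightarrow> s \<in> gp S"
  using gp_step[OF _ gp_id, of s S] by simp

lemma gp_comp: "g \<in> gp S \<Longrightarrow> h \<in> gp S \<Longrightarrow> g \<circ> h \<in> gp S"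
  by (induction rule: gp.induct) (auto simp: comp_assoc intro: gp_step)

lemma gp_mono: "g \<in> gp S \<Longrightarrow> S \<subseteq> T \<Longrightarrow> g \<in> gp T"
  by (induction rule: gp.induct) (auto intro: gp.intros)

lemma gp_empty: "g \<in> gp {} \<Longrightarrow> g = id"
  by (induction rule: gp.induct) auto

lemma gp_singleton:
  assumes "g \<in> gp {s}" "s \<circ> s = id"
  shows "g = id \<or> g = s"
  using assms by (induction rule: gp.induct) auto

lemma gp_inverse:
  assumes "g \<in> gp S" "involutive S"
  obtains g' where "g' \<in> gp S" "g' \<circ> g = id" "g \<circ> g' = id"
proof -
  have "\<exists>g'\<in>gp S. g' \<circ> g = id \<and> g \<circ> g' = id"
    using assms
  proof (induction rule: gp.induct)
    case gp_id
    then show ?case by (intro bexI[of _ id]) (auto intro: gp.gp_id)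
  next
    case (gp_step s g)
    then obtain g' where g': "g' \<in> gp S" "g' \<circ> g = id" "g \<circ> g' = id" by blast
    have s: "s \<circ> s = id" using gp_step by (auto simp: involutive_def)
    have "g' \<circ> s \<in> gp S" using g' gp_step by (auto intro: gp_comp gp_gen)
    moreover have "(g' \<circ> s) \<circ> (s \<circ> g) = id" "(s \<circ> g) \<circ> (g' \<circ> s) = id"
      using s g' by (simp_all add: fun_eq_iff)
    ultimately show ?case by blast
  qed
  then show thesis using that by blast
qed

lemma gp_cancel_left:
  assumes "a \<circ> b \<in> gp S" "a \<in> gp S" "involutive S"
  shows "b \<in> gp S"
proof -
  obtain a' where "a' \<in> gp S" "a' \<circ> a = id" using gp_inverse assms by metis
  then have "a' \<circ> (a \<circ> b) \<in> gp S" "a' \<circ> (a \<circ> b) = b"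
    using gp_comp[OF _ assms(1)] by (auto simp: fun_eq_iff)
  then show ?thesis by simp
qed

lemma gp_cancel_right:
  assumes "a \<circ> b \<in> gp S" "b \<in> gp S" "involutive S"
  shows "a \<in> gp S"
proof -
  obtain b' where "b' \<in> gp S" "b \<circ> b' = id" using gp_inverse assms by metis
  then have "(a \<circ> b) \<circ> b' \<in> gp S" "(a \<circ> b) \<circ> b' = a"
    using gp_comp[OF assms(1)] by (auto simp: fun_eq_iff)
  then show ?thesis by simp
qed

lemma gp_stable:
  assumes "g \<in> gp S" "\<And>s z. s \<in> S \<Longrightarrow> z \<in> Z \<Longrightarrow> s z \<in> Z" "z \<in> Z"
  shows "g z \<in> Z"
  using assms(1,3) by (induction rule: gp.induct) (use assms(2) in auto)

lemma gp_fix: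
  assumes "g \<in> gp S" "\<And>s. s \<in> S \<Longrightarrow> s z = z"
  shows "g z = z"
  using assms(1) by (induction rule: gp.induct) (use assms(2) in auto)

lemma gp_commute:
  assumes "g \<in> gp S" "\<And>s. s \<in> S \<Longrightarrow> s \<circ> t = t \<circ> s"
  shows "g \<circ> t = t \<circ> g"
  using assms(1)
proof (induction rule: gp.induct)
  case (gp_step s g)
  then show ?case using assms(2)[of s] by (metis comp_assoc)
qed auto

text \<open>Deleting from a word the generators that fix Z pointwise does not change its action on Z.\<close>

lemma gp_restrict:
  assumes g: "g \<in> gp S"
    and stable: "\<And>s z. s \<in> S \<Longrightarrow> z \<in> Z \<Longrightarrow> s z \<in> Z"
    and fixed: "\<And>s z. s \<in> S \<Longrightarrow> s \<notin> S' \<Longrightarrow> z \<in> Z \<Longrightarrow> s z = z"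
    and inv: "involutive S'"
  obtains t where "t \<in> gp S'" "\<And>z. z \<in> Z \<Longrightarrow> t (g z) = z"
proof -
  have "\<exists>t\<in>gp S'. \<forall>z\<in>Z. g z = t z"
    using g
  proof (induction rule: gp.induct)
    case gp_id
    then show ?case by (intro bexI[of _ id]) (auto intro: gp.gp_id)
  next
    case (gp_step s g)
    then obtain t where t: "t \<in> gp S'" "\<forall>z\<in>Z. g z = t z" by blast
    show ?case
    proof (cases "s \<in> S'")
      case True
      then show ?thesis using t by (intro bexI[of _ "s \<circ> t"]) (auto intro: gp.gp_step)
    next
      case False
      have "g z \<in> Z" if "z \<in> Z" for z
        by (rule gp_stable[of g S Z, OF gp_step(2)]) (use stable that in auto)
      then show ?thesis using t fixed[OF gp_step(1) False] by (intro bexI[of _ t]) auto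
    qed
  qed
  then obtain t where t: "t \<in> gp S'" "\<forall>z\<in>Z. g z = t z" by blast
  then obtain t' where t': "t' \<in> gp S'" "t' \<circ> t = id" using gp_inverse inv by metis
  then have "t' (g z) = z" if "z \<in> Z" for z
    using t that by (metis comp_apply id_apply)
  then show thesis using that t' by blast
qed

lemma gp_even:
  assumes "g \<in> gp S" "\<And>s. s \<in> S \<Longrightarrow> s permutes V \<and> evenperm s" "finite V"
  shows "g permutes V \<and> evenperm g"
  using assms(1)
proof (induction rule: gp.induct)
  case gp_id
  show ?case by (simp only: permutes_id evenperm_id simp_thms)
next
  case (gp_step s g)
  then have s: "s permutes V" "evenperm s" and g: "g permutes V" "evenperm g"
    using assms(2) by auto
  then have "permutation s" "permutation g" using assms(3) permutation_permutes by blast+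
  then have "evenperm (s \<circ> g)" using s g evenperm_comp[of s g] by blast
  then show ?case using permutes_compose[OF g(1) s(1)] by blast
qed

section \<open>The intersection property of commuting string groups\<close>

lemma gp_split:
  assumes "g \<in> gp (S \<union> T)" "\<And>s t. s \<in> S \<Longrightarrow> t \<in> T \<Longrightarrow> s \<circ> t = t \<circ> s"
  shows "\<exists>a\<in>gp S. \<exists>b\<in>gp T. g = a \<circ> b"
  using assms(1)
proof (induction rule: gp.induct)
  case gp_id
  then show ?case by (intro bexI[of _ id]) (auto intro: gp.gp_id)
next
  case (gp_step s g)
  then obtain a b where ab: "a \<in> gp S" "b \<in> gp T" "g = a \<circ> b" by blast
  show ?case
  proof (cases "s \<in> S")
    case True
    then have "s \<circ> a \<in> gp S" using ab by (auto intro: gp.gp_step)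
    moreover have "s \<circ> g = (s \<circ> a) \<circ> b" using ab by (simp add: comp_assoc)
    ultimately show ?thesis using ab by blast
  next
    case False
    then have s: "s \<in> T" using gp_step by auto
    then have "a \<circ> s = s \<circ> a" using gp_commute[OF ab(1)] assms(2) by blast
    then have "s \<circ> g = a \<circ> (s \<circ> b)" using ab by (metis comp_assoc)
    moreover have "s \<circ> b \<in> gp T" using ab s by (auto intro: gp.gp_step)
    ultimately show ?thesis using ab by blast
  qed
qed

text \<open>\<open>{k..m}\<close> is the longest run of consecutive elements of \<open>J\<close>
  that ends at \<open>m\<close>. By maximality the predecessor of \<open>k\<close> is not in
  \<open>J\<close>, so every other index is at distance at least 2 from the run and its generator
  commutes with the whole block.\<close>

lemma top_block:
  fixes J :: "nat set"
  assumes "m \<in> J" "J \<subseteq> {..m}"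
  obtains k J' where "J = J' \<union> {k..m}" "k \<le> m" "\<And>i. i \<in> J' \<Longrightarrow> i + 2 \<le> k"
proof -
  define k where "k = (LEAST k. {k..m} \<subseteq> J)"
  have ex: "{m..m} \<subseteq> J" using assms by auto
  have k: "{k..m} \<subseteq> J" unfolding k_def by (rule LeastI[of "\<lambda>k. {k..m} \<subseteq> J", OF ex])
  have km: "k \<le> m" unfolding k_def by (rule Least_le[of "\<lambda>k. {k..m} \<subseteq> J", OF ex])
  have min: "k \<le> l" if "{l..m} \<subseteq> J" for l unfolding k_def by (rule Least_le) (rule that)
  have "i + 2 \<le> k" if i: "i \<in> J - {k..m}" for i
  proof (rule ccontr)
    assume "\<not> i + 2 \<le> k"
    then have "k = Suc i" using i assms by auto
    then have "{i..m} \<subseteq> J" using i k 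
      by (smt (verit) DiffD1 atLeastAtMost_iff not_less_eq_eq order_antisym subset_iff)
    then show False using min \<open>k = Suc i\<close> by fastforce
  qed
  then show thesis using that[of "J - {k..m}" k] k km by blast
qed

locale string_involutions =
  fixes \<rho> :: "nat \<Rightarrow> 'a \<Rightarrow> 'a" and r :: nat
  assumes inv: "involutive (\<rho> ` {..<r})"
    and comm: "\<And>i j. j < r \<Longrightarrow> i + 2 \<le> j \<Longrightarrow> \<rho> i \<circ> \<rho> j = \<rho> j \<circ> \<rho> i"
begin

lemma gp_block_split:
  assumes "m < r" "g \<in> gp (\<rho> ` (J' \<union> {k..m}))" "\<And>i. i \<in> J' \<Longrightarrow> i + 2 \<le> k"
  shows "\<exists>a\<in>gp (\<rho> ` J'). \<exists>b\<in>gp (\<rho> ` {k..m}). g = a \<circ> b"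
proof (rule gp_split)
  show "g \<in> gp (\<rho> ` J' \<union> \<rho> ` {k..m})" using assms(2) by (simp add: image_Un)
next
  fix s t assume "s \<in> \<rho> ` J'" "t \<in> \<rho> ` {k..m}"
  then obtain i j where "i \<in> J'" "s = \<rho> i" "k \<le> j" "j \<le> m" "t = \<rho> j" by auto
  moreover from this have "i + 2 \<le> j" "j < r" using assms(1,3) by fastforce+
  ultimately show "s \<circ> t = t \<circ> s" using comm by simp
qed

text \<open>Induction on the bound \<open>m\<close>. A condition on intervals suffices because the
  part of a word that belongs to the top block commutes with the rest and can be split off. The case
  \<open>i = Suc j\<close> of \<open>crit\<close>, with \<open>{i..j}\<close> empty, is needed when
  the block is the single index \<open>m\<close>.\<close>

lemma intersection_criterion:
  assumes crit: "\<And>j i g. Suc j < r \<Longrightarrow> i \<le> Suc j \<Longrightarrow> g \<in> gp (\<rho> ` {..j})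
      \<Longrightarrow> g \<in> gp (\<rho> ` {i..<r}) \<Longrightarrow> g \<in> gp (\<rho> ` {i..j})"
    and "J \<subseteq> {..<m}" "K \<subseteq> {..<m}" "m \<le> r" "g \<in> gp (\<rho> ` J)" "g \<in> gp (\<rho> ` K)"
  shows "g \<in> gp (\<rho> ` (J \<inter> K))"
  using assms(2-)
proof (induction m arbitrary: J K g)
  case 0
  then show ?case by auto
next
  case (Suc m)
  have invr: "involutive (\<rho> ` A)" if "A \<subseteq> {..m}" for A
    by (rule involutive_subset[OF inv]) (use that Suc in auto)
  have case1: "g \<in> gp (\<rho> ` (J \<inter> K))"
    if JK: "J \<subseteq> {..m}" "K \<subseteq> {..m}" and mK: "m \<notin> K"
      and g: "g \<in> gp (\<rho> ` J)" "g \<in> gp (\<rho> ` K)" for J K g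
  proof (cases "m \<in> J")
    case False
    have "J \<subseteq> {..<m}" "K \<subseteq> {..<m}"
      using JK mK False by (auto simp: subset_iff le_less)
    then show ?thesis using Suc.IH Suc.prems(3) g by auto
  next
    case True
    then obtain k J' where J: "J = J' \<union> {k..m}" and km: "k \<le> m" and sep: "\<And>i. i \<in> J' \<Longrightarrow> i + 2 \<le> k"
      using top_block JK by metis
    have Km: "K \<subseteq> {..<m}" using JK mK by (auto simp: subset_iff le_less)
    obtain a b where ab: "a \<in> gp (\<rho> ` J')" "b \<in> gp (\<rho> ` {k..m})" "g = a \<circ> b"
      using gp_block_split[of m g J' k] sep g J Suc.prems by auto
    have Jm: "J' \<union> {k..<m} \<subseteq> {..<m}" using sep km by fastforce
    \<comment> \<open>\<open>g\<close> is a word over \<open>K\<close> and \<open>a\<close> one over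
      \<open>J'\<close>, both with indices below \<open>m\<close>. Hence \<open>b\<close> lies in
      the group of \<open>{..<m}\<close> as well, and \<open>crit\<close> removes \<open>m\<close>
      from its block.\<close>
    have "b \<in> gp (\<rho> ` {k..<m})"
    proof (cases m)
      case 0
      then have "K = {}" using Km by auto
      then have "g = id" using g gp_empty by auto
      moreover have "J' = {}" using sep km 0 by fastforce
      ultimately have "b = id" using ab gp_empty by fastforce
      then show ?thesis by (simp add: gp_id)
    next
      case (Suc m')
      have "a \<circ> b \<in> gp (\<rho> ` {..<m})" using g ab gp_mono[of _ "\<rho> ` K"] Km by blast
      moreover have "a \<in> gp (\<rho> ` {..<m})" using ab Jm by (auto intro: gp_mono)
      ultimately have "b \<in> gp (\<rho> ` {..<m})"
        using gp_cancel_left invr[of "{..<m}"] by fastforce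
      moreover have "b \<in> gp (\<rho> ` {k..<r})" using ab(2) by (rule gp_mono) (use Suc.prems in auto)
      moreover have eqs: "{..<m} = {..m'}" "{k..<m} = {k..m'}" using Suc by auto
      ultimately show ?thesis using crit[of m' k b] Suc Suc.prems(3) km by simp
    qed
    then have "g \<in> gp (\<rho> ` (J' \<union> {k..<m}))"
      using ab by (auto intro!: gp_comp intro: gp_mono)
    then have "g \<in> gp (\<rho> ` ((J' \<union> {k..<m}) \<inter> K))"
      using Suc.IH[OF Jm Km] Suc.prems(3) g by auto
    then show ?thesis by (rule gp_mono) (use J in auto)
  qed
  have JK: "J \<subseteq> {..m}" "K \<subseteq> {..m}" using Suc.prems by auto
  \<comment> \<open>Here \<open>m\<close> may lie in both sets, and the top block of
    \<open>K\<close> is contained in \<open>J\<close>. Its factor \<open>d\<close> lies in both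
    groups; dividing it out leaves \<open>c\<close>, a word over \<open>K'\<close>, which avoids
    \<open>m\<close>.\<close>
  have case2: "g \<in> gp (\<rho> ` (J \<inter> K))"
    if JK: "J \<subseteq> {..m}" and g: "g \<in> gp (\<rho> ` J)" "g \<in> gp (\<rho> ` K)"
      and K: "K = K' \<union> {l..m}" "K \<subseteq> {..m}" "\<And>i. i \<in> K' \<Longrightarrow> i + 2 \<le> l" "{l..m} \<subseteq> J" "l \<le> m" for J K g K' l
  proof -
    obtain c d where cd: "c \<in> gp (\<rho> ` K')" "d \<in> gp (\<rho> ` {l..m})" "g = c \<circ> d"
      using gp_block_split[of m g K' l] K(3) g K(1) Suc.prems by auto
    have d: "d \<in> gp (\<rho> ` (J \<inter> K))" "d \<in> gp (\<rho> ` J)"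
      using cd(2) K by (auto elim!: gp_mono)
    have "c \<in> gp (\<rho> ` J)" using g(1) d invr[OF JK] gp_cancel_right cd(3) by blast
    moreover have "m \<notin> K'" using K by fastforce
    ultimately have "c \<in> gp (\<rho> ` (J \<inter> K'))" using case1[of J K' c] JK K cd(1) by auto
    then have "c \<in> gp (\<rho> ` (J \<inter> K))" by (rule gp_mono) (use K in auto)
    then show ?thesis using cd d gp_comp by auto
  qed
  consider "m \<notin> K" | "m \<notin> J" | "m \<in> J" "m \<in> K" by auto
  then show ?case
  proof cases
    case 1
    then show ?thesis using case1 JK Suc.prems by auto
  next
    case 2
    then show ?thesis using case1[of K J g] JK Suc.prems by (auto simp: Int_commute)
  next
    case 3
    obtain k J' where J: "J = J' \<union> {k..m}" "k \<le> m" "\<And>i. i \<in> J' \<Longrightarrow> i + 2 \<le> k"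
      using top_block 3 JK by metis
    obtain l K' where K: "K = K' \<union> {l..m}" "l \<le> m" "\<And>i. i \<in> K' \<Longrightarrow> i + 2 \<le> l"
      using top_block 3 JK by metis
    show ?thesis
    proof (cases "k \<le> l")
      case True
      then have "{l..m} \<subseteq> J" using J by auto
      then show ?thesis using case2[of J g K K' l] J K JK Suc.prems by blast
    next
      case False
      then have "{k..m} \<subseteq> K" using K by auto
      then show ?thesis using case2[of K g J J' k] J K JK Suc.prems by (metis Int_commute)
    qed
  qed
qed

end

section \<open>Alternating groups inside generated groups\<close>

definition alt_in :: "('a \<Rightarrow> 'a) set \<Rightarrow> 'a set \<Rightarrow> bool" where
  "alt_in S Y \<longleftrightarrow> (\<forall>p. p permutes Y \<longrightarrow> evenperm p \<longrightarrow> p \<in> gp S)"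

lemma alt_in_mono: "alt_in S Y \<Longrightarrow> Z \<subseteq> Y \<Longrightarrow> alt_in S Z"
  unfolding alt_in_def using permutes_subset by blast

abbreviation cyc3 :: "'a \<Rightarrow> 'a \<Rightarrow> 'a \<Rightarrow> 'a \<Rightarrow> 'a" where
  "cyc3 a b c \<equiv> transpose a b \<circ> transpose b c"

lemma cyc3_permutes: "{a, b, c} \<subseteq> Y \<Longrightarrow> cyc3 a b c permutes Y"
  by (intro permutes_compose permutes_swap_id) auto

lemma cyc3_even: "a \<noteq> b \<Longrightarrow> b \<noteq> c \<Longrightarrow> evenperm (cyc3 a b c)"
  by (simp add: evenperm_comp evenperm_swap permutation_swap_id)

lemma cyc3_apply:
  "a \<noteq> b \<Longrightarrow> b \<noteq> c \<Longrightarrow> a \<noteq> c \<Longrightarrow> cyc3 a b c a = b"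
  "a \<noteq> b \<Longrightarrow> b \<noteq> c \<Longrightarrow> a \<noteq> c \<Longrightarrow> cyc3 a b c b = c"
  "a \<noteq> b \<Longrightarrow> b \<noteq> c \<Longrightarrow> a \<noteq> c \<Longrightarrow> cyc3 a b c c = a"
  by (auto simp: transpose_def)

lemma cyc3_cube: "a \<noteq> b \<Longrightarrow> b \<noteq> c \<Longrightarrow> a \<noteq> c \<Longrightarrow> cyc3 a b c \<circ> (cyc3 a b c \<circ> cyc3 a b c) = id"
  by (auto simp: fun_eq_iff transpose_def)

lemma order3_cancel:
  assumes "c \<circ> (c \<circ> c) = id"
  shows "c \<circ> p = id \<Longrightarrow> p = c \<circ> c" "c \<circ> (c \<circ> p) = id \<Longrightarrow> p = c"
  using assms by (auto simp: fun_eq_iff) metis+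

lemma transpose_conj:
  assumes "bij g"
  shows "g \<circ> transpose a b \<circ> inv' g = transpose (g a) (g b)"
proof
  fix x
  obtain y where "x = g y" using assms by (metis bij_pointE)
  then show "(g \<circ> transpose a b \<circ> inv' g) x = transpose (g a) (g b) x"
    using assms by (auto simp: transpose_def bij_is_inj inj_eq)
qed

lemma gp_bij: "g \<in> gp S \<Longrightarrow> involutive S \<Longrightarrow> bij g"
  by (metis gp_inverse o_bij)

lemma gp_inv: "g \<in> gp S \<Longrightarrow> involutive S \<Longrightarrow> inv' g \<in> gp S"
  by (metis gp_inverse inv_unique_comp)

text \<open>A 3-cycle through x and two further points of Y, conjugated by g, links the new point g x to Y.\<close>

lemma alt_in_grow:
  assumes alt: "alt_in S Y" and inv: "involutive S" and fin: "finite Y"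
    and g: "g \<in> gp S" and x: "x \<in> Y"
    and ab: "a \<in> Y" "b \<in> Y" "a \<noteq> b" "a \<noteq> x" "b \<noteq> x" "g a \<in> Y" "g b \<in> Y"
  shows "alt_in S (insert (g x) Y)"
proof (cases "g x \<in> Y")
  case True
  then show ?thesis using alt by (simp add: insert_absorb)
next
  case False
  let ?y = "g x"
  have bij: "bij g" using gp_bij g inv by blast
  have inj: "g u = g v \<longleftrightarrow> u = v" for u v using bij by (simp add: bij_is_inj inj_eq)
  have gpalt: "p \<in> gp S" if "p permutes Y" "evenperm p" for p
    using alt that by (auto simp: alt_in_def)
  define c where "c = cyc3 (g a) (g x) (g b)"
  have "c = (g \<circ> transpose a x \<circ> inv' g) \<circ> (g \<circ> transpose x b \<circ> inv' g)"
    unfolding c_def transpose_conj[OF bij] ..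
  also have "\<dots> = g \<circ> cyc3 a x b \<circ> inv' g"
    using bij by (simp add: fun_eq_iff bij_is_inj)
  finally have "c = g \<circ> cyc3 a x b \<circ> inv' g" .
  moreover have "cyc3 a x b \<in> gp S"
    using ab x by (intro gpalt cyc3_permutes cyc3_even) auto
  ultimately have c: "c \<in> gp S" using g gp_inv[OF g inv] by (auto intro: gp_comp)
  have perm_c: "c permutes insert ?y Y" "evenperm c" "c (g a) = ?y"
    unfolding c_def using ab x inj
    by (auto intro!: cyc3_permutes cyc3_even simp: cyc3_apply simp del: comp_apply)
  show ?thesis unfolding alt_in_def
  proof (intro allI impI)
    fix p assume p: "p permutes insert ?y Y" "evenperm p"
    have finy: "finite (insert ?y Y)" using fin by simp
    have perm: "permutation q" if "q permutes insert ?y Y" for q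
      using that finy permutation_permutes by blast
    have down: "q permutes Y" if "q permutes insert ?y Y" "q ?y = ?y" for q
      using permutes_superset[OF that(1), of Y] that(2) by auto
    show "p \<in> gp S"
    proof (cases "p ?y = ?y")
      case True
      then show ?thesis using down p gpalt by blast
    next
      case False
      then have py: "p ?y \<in> Y" using p(1) by (metis insertE insertI1 permutes_in_image)
      \<comment> \<open>\<open>s\<close> moves \<open>p ?y\<close> to \<open>g a\<close> inside
        \<open>Y\<close> and \<open>c\<close> moves that to \<open>?y\<close>, so
        \<open>c \<circ> s \<circ> p\<close> fixes \<open>?y\<close> and is an even permutation of
        \<open>Y\<close>. Since \<open>s\<close> must be even, a third point \<open>w\<close> of
        \<open>Y\<close> completes it to a 3-cycle.\<close>
      obtain s where s: "s permutes Y" "evenperm s" "s (p ?y) = g a"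
      proof (cases "p ?y = g a")
        case True
        then show thesis using that[of id] permutes_id evenperm_id by (metis id_apply)
      next
        case neq: False
        obtain w where w: "w \<in> Y" "w \<noteq> g a" "w \<noteq> p ?y"
          using ab x by (metis (full_types))
        show thesis
          by (rule that[of "cyc3 (p ?y) (g a) w"])
             (use neq w ab py in \<open>auto intro!: cyc3_permutes cyc3_even simp: cyc3_apply simp del: comp_apply\<close>)
      qed
      define q where "q = c \<circ> s \<circ> p"
      have sy: "s permutes insert ?y Y" using s(1) by (rule permutes_subset) auto
      have "q permutes insert ?y Y"
        unfolding q_def using perm_c sy p by (intro permutes_compose) auto
      moreover have "q ?y = ?y" using s perm_c by (simp add: q_def)
      ultimately have "q permutes Y" by (rule down)
      moreover have "evenperm q"
        unfolding q_def using perm perm_c sy s p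
        by (simp add: evenperm_comp permutation_compose)
      ultimately have "q \<in> gp S" by (rule gpalt)
      moreover have "c \<circ> s \<in> gp S" using c gpalt s gp_comp by blast
      ultimately show ?thesis using gp_cancel_left[of "c \<circ> s" p] inv q_def by auto
    qed
  qed
qed

text \<open>A power of the 3-cycle brings \<open>p a\<close> back to \<open>a\<close>; what is left
  is an even permutation of \<open>{b, c}\<close>, hence the identity.\<close>

lemma alt_in_cyc3:
  assumes "cyc3 a b c \<in> gp S" "a \<noteq> b" "b \<noteq> c" "a \<noteq> c"
  shows "alt_in S {a, b, c}"
  unfolding alt_in_def
proof (intro allI impI)
  fix p assume p: "p permutes {a, b, c}" "evenperm p"
  let ?c = "cyc3 a b c"
  have down: "q = id" if q: "q permutes {a, b, c}" "evenperm q" "q a = a" for q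
  proof -
    have "q permutes {b, c}" using permutes_superset[OF q(1), of "{b, c}"] q(3) by auto
    then have "q = id \<or> q = transpose b c"
      by (simp add: permutes_doubleton_iff)
    then show ?thesis using q(2) assms by (auto simp: evenperm_swap)
  qed
  have c: "?c permutes {a, b, c}" by (rule cyc3_permutes) auto
  have ce: "evenperm ?c" using assms by (intro cyc3_even) auto
  have perm: "permutation q" if "q permutes {a, b, c}" for q
    using that permutation_permutes finite.emptyI finite_insert by metis
  have "p a \<in> {a, b, c}" using permutes_in_image[OF p(1), of a] by simp
  then consider "p a = a" | "?c (p a) = a" | "?c (?c (p a)) = a"
    using cyc3_apply[OF assms(2-4)] by auto
  then show "p \<in> gp S"
  proof cases
    case 1
    then show ?thesis using down p gp_id by metis
  next
    case 2
    have "?c \<circ> p permutes {a, b, c}" "evenperm (?c \<circ> p)"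
      using permutes_compose[OF p(1) c] evenperm_comp[OF perm[OF c] perm[OF p(1)]] ce p(2) by blast+
    then have "?c \<circ> p = id" by (rule down) (use 2 in simp)
    then have "p = ?c \<circ> ?c" by (rule order3_cancel(1)[OF cyc3_cube[OF assms(2-4)]])
    then show ?thesis using gp_comp[OF assms(1,1)] by simp
  next
    case 3
    have cp: "?c \<circ> p permutes {a, b, c}" "evenperm (?c \<circ> p)"
      using permutes_compose[OF p(1) c] evenperm_comp[OF perm[OF c] perm[OF p(1)]] ce p(2) by blast+
    then have "?c \<circ> (?c \<circ> p) permutes {a, b, c}" "evenperm (?c \<circ> (?c \<circ> p))"
      using permutes_compose[OF cp(1) c] evenperm_comp[OF perm[OF c] perm[OF cp(1)]] ce by blast+
    then have "?c \<circ> (?c \<circ> p) = id" by (rule down) (use 3 in simp)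
    then have "p = ?c" by (rule order3_cancel(2)[OF cyc3_cube[OF assms(2-4)]])
    then show ?thesis using assms(1) by simp
  qed
qed

text \<open>Maximality turns \<open>alt_in_grow\<close> into a closure rule: an element that keeps
  two other points of \<open>Y\<close> inside \<open>Y\<close> cannot take a point of
  \<open>Y\<close> to a new point of \<open>V\<close>. Membership in \<open>Y\<close> then spreads
  along the graph by ordinary induction.\<close>

lemma alt_in_maximal:
  assumes fin: "finite V" and Y0: "Y0 \<subseteq> V" "alt_in S Y0" and inv: "involutive S"
  obtains Y where "Y0 \<subseteq> Y" "Y \<subseteq> V" "alt_in S Y"
    "\<And>g x a b. g \<in> gp S \<Longrightarrow> x \<in> Y \<Longrightarrow> a \<in> Y \<Longrightarrow> b \<in> Y \<Longrightarrow> a \<noteq> b \<Longrightarrow> a \<noteq> x \<Longrightarrow> b \<noteq> x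
      \<Longrightarrow> g a \<in> Y \<Longrightarrow> g b \<in> Y \<Longrightarrow> g x \<in> V \<Longrightarrow> g x \<in> Y"
proof -
  let ?\<Y> = "{Y. Y \<subseteq> V \<and> alt_in S Y}"
  have "finite ?\<Y>" using fin by simp
  then obtain Y where Y: "Y \<in> ?\<Y>" "Y0 \<subseteq> Y" and max: "\<And>Z. Z \<in> ?\<Y> \<Longrightarrow> Y \<subseteq> Z \<Longrightarrow> Y = Z"
    using finite_has_maximal2[of ?\<Y> Y0] Y0 by auto
  show thesis
  proof (rule that[of Y])
    fix g x a b
    assume *: "g \<in> gp S" "x \<in> Y" "a \<in> Y" "b \<in> Y" "a \<noteq> b" "a \<noteq> x" "b \<noteq> x"
      "g a \<in> Y" "g b \<in> Y" "g x \<in> V"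
    have "finite Y" using Y fin finite_subset by auto
    then have "alt_in S (insert (g x) Y)"
      using alt_in_grow[of S Y g x a b] Y inv * by auto
    then show "g x \<in> Y" using max[of "insert (g x) Y"] Y * by auto
  qed (use Y in auto)
qed

section \<open>The vertices and the generators\<close>

text \<open>The path from p_1 to y_2 becomes F 1, ..., F M with M = n - 2 r + 2; the vertices y_j and z_j become
  T False j and T True j. We write r = e + 4, so that e is the index of the generator that swaps the sides.
  W permutes the indices by \<open>\<pi>\<close> and exchanges y_j with z_j wherever a j holds.\<close>

datatype pt = F nat | T bool nat

definition W :: "(nat \<Rightarrow> nat) \<Rightarrow> (nat \<Rightarrow> bool) \<Rightarrow> pt \<Rightarrow> pt" where
  "W \<pi> a p = (case p of F x \<Rightarrow> F x | T s j \<Rightarrow> T (s \<noteq> a j) (\<pi> j))"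

lemma W_simps [simp]: "W \<pi> a (F x) = F x" "W \<pi> a (T s j) = T (s \<noteq> a j) (\<pi> j)"
  by (simp_all add: W_def)

lemma W_comp: "W \<pi> a \<circ> W \<sigma> b = W (\<pi> \<circ> \<sigma>) (\<lambda>j. b j \<noteq> a (\<sigma> j))"
  by (rule ext, rename_tac p, case_tac p) auto

lemma W_id: "W id (\<lambda>_. False) = id"
  by (rule ext, rename_tac p, case_tac p) auto

text \<open>The number of transpositions in \<open>R 0\<close> and \<open>R 1\<close> depends on
  \<open>M\<close>, so their parity needs a product of variable length; all other generators can be
  written out.\<close>

primrec swaps :: "(nat \<Rightarrow> 'a) \<Rightarrow> (nat \<Rightarrow> 'a) \<Rightarrow> nat \<Rightarrow> 'a \<Rightarrow> 'a" where
  "swaps f g 0 = id"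
| "swaps f g (Suc m) = transpose (f m) (g m) \<circ> swaps f g m"

lemma swaps_parity:
  assumes "\<And>i. f i \<noteq> g i"
  shows "permutation (swaps f g m) \<and> evenperm (swaps f g m) = even m"
proof (induction m)
  case (Suc m)
  then show ?case
    using assms permutation_swap_id[of "f m" "g m"]
    by (simp only: swaps.simps evenperm_comp permutation_compose evenperm_swap) auto
qed (auto simp: permutation_id[unfolded id_def] id_def[symmetric])

lemma swaps_path:
  "swaps (\<lambda>i. F (2 * i + c)) (\<lambda>i. F (Suc (2 * i + c))) m (F x)
    = F (if c \<le> x \<and> x < c + 2 * m then (if even (x - c) then x + 1 else x - 1) else x)"
proof (induction m)
  case (Suc m)
  consider "x = 2 * m + c" | "x = 2 * m + c + 1" | "x < 2 * m + c" | "x > 2 * m + c + 1" by linarith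
  then show ?case
  proof cases
    case 3
    have "x + 1 < 2 * m + c" if "c \<le> x" "even (x - c)" using that 3 by presburger
    then show ?thesis using Suc 3 by (auto simp: transpose_def)
  qed (use Suc in \<open>auto simp: transpose_def\<close>)
qed auto

lemma swaps_T: "swaps (\<lambda>i. F (f i)) (\<lambda>i. F (g i)) m (T s j) = T s j"
  by (induction m) (auto simp: transpose_def)

text \<open>\<open>M mod 4 = 1\<close> makes (M - 1)/2 even. \<open>9 \<le> M\<close> keeps the
  cycles of \<open>R 1 \<circ> R 2\<close> near the double edge and at the end of the path disjoint.
  \<open>4 \<le> e\<close> ensures that the generator before \<open>R e\<close> still acts on the
  tails only.\<close>

locale pt_graph =
  fixes M e :: nat
  assumes M: "9 \<le> M" "M mod 4 = 1" and e: "4 \<le> e"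
begin

text \<open>The second factor for \<open>k = e + 2\<close> stands for the edges between the indices
  r and r + 1, which carry the label r - 2. No other generator moves the index \<open>e + 5\<close>;
  \<open>R e\<close> only exchanges its two sides.\<close>

definition tr :: "nat \<Rightarrow> nat \<Rightarrow> nat" where
  "tr k = (if k = e + 2 then transpose (e + 2) (e + 3) \<circ> transpose (e + 4) (e + 5) else transpose k (k + 1))"

definition sw :: "nat \<Rightarrow> nat \<Rightarrow> bool" where
  "sw k j \<longleftrightarrow> k = e \<and> e + 2 \<le> j \<and> j \<le> e + 5"

text \<open>On the path the edge from x to x + 1 has label 0 for odd x and 1 for even x. As
  \<open>M\<close> is odd, \<open>R 0\<close> fixes \<open>F M\<close>, while \<open>R 1\<close>
  fixes \<open>F 1\<close>.\<close>

definition R0 :: "pt \<Rightarrow> pt" where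
  "R0 p = (case p of F x \<Rightarrow> F (if 1 \<le> x \<and> x < M then (if odd x then x + 1 else x - 1) else x) | T s j \<Rightarrow> T s j)"

definition R1 :: "pt \<Rightarrow> pt" where
  "R1 p = (case p of F x \<Rightarrow> F (if 2 \<le> x \<and> x \<le> M then (if even x then x + 1 else x - 1) else x) | T s j \<Rightarrow> T s j)"

definition R2 :: "pt \<Rightarrow> pt" where
  "R2 p = (case p of F x \<Rightarrow> if x = 3 then F 4 else if x = 4 then F 3 else if x = M then T False 3 else F x
     | T s j \<Rightarrow> if \<not> s \<and> j = 3 then F M else T s j)"

definition R :: "nat \<Rightarrow> pt \<Rightarrow> pt" where
  "R k = (if k = 0 then R0 else if k = 1 then R1 else if k = 2 then R2 else W (tr k) (sw k))"

definition V :: "pt set" where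
  "V = F ` {1..M} \<union> {T s j | s j. 3 \<le> j \<and> j \<le> e + 5}"

lemma V_iff [simp]: "F x \<in> V \<longleftrightarrow> 1 \<le> x \<and> x \<le> M" "T s j \<in> V \<longleftrightarrow> 3 \<le> j \<and> j \<le> e + 5"
  by (auto simp: V_def)

lemma finite_V [simp]: "finite V"
proof -
  have "V \<subseteq> F ` {1..M} \<union> (\<lambda>(s, j). T s j) ` (UNIV \<times> {3..e + 5})" by (auto simp: V_def)
  then show ?thesis by (rule finite_subset) auto
qed

section \<open>Involutions, commutation and parity of the generators\<close>

lemma M_odd: "odd M"
  using M by presburger

lemma odd_less: "odd x \<Longrightarrow> x < M \<Longrightarrow> Suc x < M"
  using M_odd by presburger

lemma even_less: "even x \<Longrightarrow> x \<le> M \<Longrightarrow> Suc x \<le> M"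
  using M_odd by presburger

lemma R_simps:
  "R 0 (F x) = F (if 1 \<le> x \<and> x < M then (if odd x then x + 1 else x - 1) else x)"
  "R (Suc 0) (F x) = F (if 2 \<le> x \<and> x \<le> M then (if even x then x + 1 else x - 1) else x)"
  "R 2 (F x) = (if x = 3 then F 4 else if x = 4 then F 3 else if x = M then T False 3 else F x)"
  "3 \<le> k \<Longrightarrow> R k (F x) = F x"
  "R 0 (T s j) = T s j" "R (Suc 0) (T s j) = T s j"
  "R 2 (T s j) = (if \<not> s \<and> j = 3 then F M else T s j)"
  "3 \<le> k \<Longrightarrow> R k (T s j) = T (s \<noteq> sw k j) (tr k j)"
  by (simp_all add: R_def R0_def R1_def R2_def)

lemma R_W: "3 \<le> k \<Longrightarrow> R k = W (tr k) (sw k)"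
  by (simp add: R_def)

lemma tr_tr: "tr k (tr k j) = j"
  by (simp add: tr_def transpose_def)

lemma tr_sw: "sw k (tr k j) = sw k j"
  by (auto simp: tr_def sw_def transpose_def)

lemma R_R: "R k (R k p) = p"
proof -
  consider "k = 0" | "k = 1" | "k = 2" | "3 \<le> k" by linarith
  then show ?thesis
  proof cases
    case 1
    then show ?thesis using odd_less by (cases p) (auto simp: R_simps)
  next
    case 2
    have "odd x \<Longrightarrow> 2 \<le> x \<Longrightarrow> 2 \<le> x - Suc 0" for x by presburger
    with 2 show ?thesis using even_less by (cases p) (auto simp: R_simps)
  next
    case 3
    then show ?thesis using M(1) by (cases p) (auto simp: R_simps)
  next
    case 4
    then show ?thesis by (cases p) (auto simp: R_simps tr_tr tr_sw)
  qed
qed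

lemma involutive_R: "involutive (R ` A)"
  by (auto simp: involutive_def fun_eq_iff R_R)

lemma tr_comm: "i + 2 \<le> j \<Longrightarrow> j < e + 4 \<Longrightarrow> tr i (tr j x) = tr j (tr i x)"
  by (auto simp: tr_def transpose_def)

lemma sw_tr: "i + 2 \<le> j \<or> j + 2 \<le> i \<Longrightarrow> i < e + 4 \<Longrightarrow> sw j (tr i x) = sw j x"
  by (auto simp: tr_def sw_def transpose_def)

lemma R_comm:
  assumes "i + 2 \<le> j" "j < e + 4"
  shows "R i \<circ> R j = R j \<circ> R i"
proof
  fix p
  consider "i = 0" "j = 2" | "i = 0" "3 \<le> j" | "i = 1" "3 \<le> j" | "i = 2" "4 \<le> j" | "3 \<le> i" "5 \<le> j"
    using assms by linarith
  then show "(R i \<circ> R j) p = (R j \<circ> R i) p"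
  proof cases
    \<comment> \<open>On the double edge between \<open>F 3\<close> and \<open>F 4\<close> both
      generators act alike, and \<open>F M\<close>, which \<open>R 2\<close> moves, is fixed by
      \<open>R 0\<close> because \<open>M\<close> is odd.\<close>
    case 1
    then show ?thesis using M(1) M_odd by (cases p) (auto simp: R_simps)
  next
    case 4
    have "tr j x = 3 \<longleftrightarrow> x = 3" "\<not> sw j 3" for x
      using 4 e by (auto simp: tr_def transpose_def sw_def)
    then show ?thesis using 4 by (cases p) (auto simp: R_simps)
  next
    case 5
    then show ?thesis
      using tr_comm[OF assms] sw_tr[of i j] sw_tr[of j i] assms
      by (cases p) (auto simp: R_simps)
  qed (cases p; auto simp: R_simps)+
qed

lemma R_in_V: "k < e + 4 \<Longrightarrow> p \<in> V \<Longrightarrow> R k p \<in> V"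
proof -
  assume k: "k < e + 4" and p: "p \<in> V"
  consider "k = 0" | "k = 1" | "k = 2" | "3 \<le> k" by linarith
  then show ?thesis
  proof cases
    case 4
    then have "3 \<le> tr k j \<and> tr k j \<le> e + 5" if "3 \<le> j \<and> j \<le> e + 5" for j
      using that k by (auto simp: tr_def transpose_def)
    then show ?thesis using p 4 by (cases p) (auto simp: R_simps)
  qed (use p M(1) odd_less even_less in \<open>cases p; force simp: R_simps split: if_splits\<close>)+
qed

lemma R_out_V: "k < e + 4 \<Longrightarrow> p \<notin> V \<Longrightarrow> R k p = p"
proof -
  assume k: "k < e + 4" and p: "p \<notin> V"
  consider "k = 0" | "k = 1" | "k = 2" | "3 \<le> k" by linarith
  then show ?thesis
  proof cases
    case 4
    then have "tr k j = j \<and> \<not> sw k j" if "\<not> (3 \<le> j \<and> j \<le> e + 5)" for j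
      using that k e by (auto simp: tr_def transpose_def sw_def)
    then show ?thesis using p 4 by (cases p) (auto simp: R_simps)
  qed (use p M(1) odd_less even_less in \<open>cases p; force simp: R_simps split: if_splits\<close>)+
qed

lemma R_permutes: "k < e + 4 \<Longrightarrow> R k permutes V"
proof (rule bij_imp_permutes)
  assume k: "k < e + 4"
  show "bij_betw (R k) V V"
    by (rule bij_betwI[of _ _ _ "R k"]) (use k R_in_V R_R in auto)
qed (use R_out_V in auto)

text \<open>Numbers of transpositions: (M - 1)/2 for \<open>R 0\<close> and \<open>R 1\<close>; 6
  for \<open>R e\<close>, from two tail edges and four exchanges of sides; 4 for
  \<open>R (e + 2)\<close>; 2 for the others.\<close>

lemma R_even: "k < e + 4 \<Longrightarrow> evenperm (R k)"
proof -
  assume k: "k < e + 4"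
  have half: "even ((M - 1) div 2)" "M = 1 + 2 * ((M - 1) div 2)" using M by presburger+
  let ?m = "(M - 1) div 2"
  consider "k = 0" | "k = 1" | "k = 2" | "3 \<le> k" "k \<noteq> e" "k \<noteq> e + 2" | "k = e" | "k = e + 2" by linarith
  then show ?thesis
  proof cases
    case 1
    have "R 0 = swaps (\<lambda>i. F (2 * i + 1)) (\<lambda>i. F (Suc (2 * i + 1))) ?m"
    proof
      fix p show "R 0 p = swaps (\<lambda>i. F (2 * i + 1)) (\<lambda>i. F (Suc (2 * i + 1))) ?m p"
        by (cases p; simp only: R_simps swaps_path swaps_T) (use half M_odd in auto)
    qed
    then show ?thesis using swaps_parity[of "\<lambda>i. F (2 * i + 1)" "\<lambda>i. F (Suc (2 * i + 1))" ?m] half 1 by simp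
  next
    case 2
    have "R 1 = swaps (\<lambda>i. F (2 * i + 2)) (\<lambda>i. F (Suc (2 * i + 2))) ?m"
    proof
      fix p show "R 1 p = swaps (\<lambda>i. F (2 * i + 2)) (\<lambda>i. F (Suc (2 * i + 2))) ?m p"
        by (cases p; simp only: R_simps swaps_path swaps_T One_nat_def) (use half M_odd in auto)
    qed
    then show ?thesis using swaps_parity[of "\<lambda>i. F (2 * i + 2)" "\<lambda>i. F (Suc (2 * i + 2))" ?m] half 2 by simp
  next
    case 3
    have "R 2 = transpose (F 3) (F 4) \<circ> transpose (F M) (T False 3)"
    proof
      fix p show "R 2 p = (transpose (F 3) (F 4) \<circ> transpose (F M) (T False 3)) p"
        using M by (cases p) (auto simp: R_simps transpose_def)
    qed
    then show ?thesis using 3 by (simp only: evenperm_comp permutation_swap_id evenperm_swap) simp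
  next
    case 4
    have "R k = transpose (T False k) (T False (k + 1)) \<circ> transpose (T True k) (T True (k + 1))"
    proof
      fix p show "R k p = (transpose (T False k) (T False (k + 1)) \<circ> transpose (T True k) (T True (k + 1))) p"
        using 4 by (cases p) (auto simp: R_simps transpose_def tr_def sw_def)
    qed
    then show ?thesis by (simp only: evenperm_comp permutation_swap_id evenperm_swap) simp
  next
    case 5
    have "R k = ((transpose (T False e) (T False (e + 1)) \<circ> transpose (T True e) (T True (e + 1)))
       \<circ> (transpose (T False (e + 2)) (T True (e + 2)) \<circ> transpose (T False (e + 3)) (T True (e + 3))))
       \<circ> (transpose (T False (e + 4)) (T True (e + 4)) \<circ> transpose (T False (e + 5)) (T True (e + 5)))" (is "_ = ?g")
    proof
      fix p
      have 3: "3 \<le> e" using e by simp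
      show "R k p = ?g p"
      proof (cases p)
        case (T s j)
        consider "j < e" | "j = e" | "j = e + 1" | "j = e + 2" | "j = e + 3" | "j = e + 4" | "j = e + 5" | "j > e + 5" by linarith
        then show ?thesis using T 5 by cases (auto simp: R_simps(8)[OF 3] transpose_def tr_def sw_def)
      qed (use 5 in \<open>auto simp: R_simps(4)[OF 3] transpose_def\<close>)
    qed
    then show ?thesis by (simp only: evenperm_comp permutation_compose permutation_swap_id evenperm_swap) simp
  next
    case 6
    have "R k = (transpose (T False (e + 2)) (T False (e + 3)) \<circ> transpose (T True (e + 2)) (T True (e + 3)))
       \<circ> (transpose (T False (e + 4)) (T False (e + 5)) \<circ> transpose (T True (e + 4)) (T True (e + 5)))" (is "_ = ?g")
    proof
      fix p
      have 3: "3 \<le> Suc (Suc e)" using e by simp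
      show "R k p = ?g p"
      proof (cases p)
        case (T s j)
        consider "j < e + 2" | "j = e + 2" | "j = e + 3" | "j = e + 4" | "j = e + 5" | "j > e + 5" by linarith
        then show ?thesis using T 6 by cases (auto simp: R_simps(8)[OF 3] transpose_def tr_def sw_def)
      qed (use 6 in \<open>auto simp: R_simps(4)[OF 3] transpose_def\<close>)
    qed
    then show ?thesis by (simp only: evenperm_comp permutation_compose permutation_swap_id evenperm_swap) simp
  qed
qed

lemma gp_R_even: "g \<in> gp (R ` A) \<Longrightarrow> A \<subseteq> {..<e + 4} \<Longrightarrow> g permutes V \<and> evenperm g"
  by (rule gp_even) (use R_permutes R_even in auto)


section \<open>The intersection condition for the dihedral group of the front path\<close>

sublocale string_involutions R "e + 4"
  by unfold_locales (rule involutive_R, rule R_comm)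

lemma R_front_fixed: "2 \<le> k \<Longrightarrow> x \<notin> {3, 4, M} \<Longrightarrow> R k (F x) = F x"
  by (cases "k = 2") (auto simp: R_simps)

definition rot :: "pt \<Rightarrow> pt" where "rot = R 0 \<circ> R 1"
definition rot' :: "pt \<Rightarrow> pt" where "rot' = R 1 \<circ> R 0"

lemma rot_F:
  "1 \<le> x \<Longrightarrow> x \<le> M \<Longrightarrow> rot (F x) = F (if x = 1 then 2 else if x = M - 1 then M else if even x then x + 2 else x - 2)"
  using M(1) M_odd odd_less[of x] odd_less[of "x + 1"] even_less[of x] even_less[of "x + 1"]
  by (auto simp: rot_def R_simps)

text \<open>\<open>rot\<close> is one cycle through the whole path: 1, 2, 4, ..., M - 1, M, M - 2,
  ..., 3 and back to 1, even numbers on the way up and odd ones on the way down.\<close>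

lemma rot_pow_F:
  "m \<le> M \<Longrightarrow> (rot ^^ m) (F 1) = F (if m = 0 then 1 else if 2 * m < M then 2 * m else 2 * (M - m) + 1)"
proof (induction m)
  case (Suc m)
  have "rot (F (if m = 0 then 1 else if 2 * m < M then 2 * m else 2 * (M - m) + 1))
    = F (if 2 * Suc m < M then 2 * Suc m else 2 * (M - Suc m) + 1)"
  proof (cases "2 * m < M")
    case True
    then show ?thesis using Suc.prems M_odd M(1) rot_F[of "if m = 0 then 1 else 2 * m"]
      by (auto elim!: oddE)
  next
    case False
    obtain d where d: "M = Suc (d + m)" using Suc.prems by (metis Suc_le_D add.commute add_Suc le_Suc_ex)
    then have "2 * d + 3 \<le> M" using False M_odd by presburger
    moreover have "2 * d + 3 \<noteq> M - 1" using M_odd by presburger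
    ultimately have "rot (F (2 * d + 3)) = F (2 * d + 1)" using rot_F[of "2 * d + 3"] by auto
    then have "rot (F (2 * (M - m) + 1)) = F (2 * (M - Suc m) + 1)"
      using arg_cong[OF d, of "\<lambda>x. x - m"] arg_cong[OF d, of "\<lambda>x. x - Suc m"] by (simp add: numeral_3_eq_3)
    moreover have "m \<noteq> 0" using False M(1) by auto
    moreover have "\<not> 2 * Suc m < M" using False by simp
    ultimately show ?thesis using False by simp
  qed
  then show ?case using Suc by simp
qed simp

lemma rot_orbit:
  assumes "1 \<le> x" "x \<le> M"
  obtains m where "(rot ^^ m) (F 1) = F x"
proof -
  have "x = 1 \<or> (x = 2 * (x div 2) \<and> x div 2 \<noteq> 0 \<and> 2 * (x div 2) < M) \<or> (x = 2 * (x div 2) + 1 \<and> x div 2 \<noteq> 0)"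
    using assms M_odd by presburger
  then consider "x = 1" | y where "x = 2 * y" "y \<noteq> 0" "2 * y < M" | y where "x = 2 * y + 1" "y \<noteq> 0"
    by blast
  then show thesis
  proof cases
    case 1
    then show thesis using that[of 0] by simp
  next
    case 2
    then show thesis using that[of y] rot_pow_F[of y] by simp
  next
    case 3
    have "M - y \<le> M" "M - y \<noteq> 0" "\<not> 2 * (M - y) < M" "M - (M - y) = y" using 3 assms by auto
    then show thesis using that[of "M - y"] rot_pow_F[of "M - y"] 3 by simp
  qed
qed

lemma rot_rot': "rot \<circ> R 0 = R 0 \<circ> rot'" "rot \<circ> R 1 = R 1 \<circ> rot'" "rot' \<circ> R 0 = R 0 \<circ> rot" "rot' \<circ> R 1 = R 1 \<circ> rot"
  by (auto simp: fun_eq_iff rot_def rot'_def R_R)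

text \<open>\<open>rot'\<close> is the inverse of \<open>rot\<close>, and each of the two
  reflections swaps them by conjugation. So the parity of the word length decides between the
  alternatives.\<close>

lemma dihedral_conj:
  assumes "g \<in> gp (R ` {0, 1})"
  shows "(rot \<circ> g = g \<circ> rot \<and> rot' \<circ> g = g \<circ> rot') \<or> (rot \<circ> g = g \<circ> rot' \<and> rot' \<circ> g = g \<circ> rot)"
  using assms
proof (induction rule: gp.induct)
  case (gp_step s g)
  then have "s = R 0 \<or> s = R 1" by auto
  then have "rot \<circ> s = s \<circ> rot'" "rot' \<circ> s = s \<circ> rot" using rot_rot' by auto
  then show ?case using gp_step.IH by (metis comp_assoc)
qed simp

text \<open>\<open>rot\<close> is transitive on the path, so an element commuting with it is
  determined there by the image of a single vertex.\<close>

lemma dihedral_fix: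
  assumes "g \<in> gp (R ` {0, 1})" "g (F 1) = F 1" "rot \<circ> g = g \<circ> rot"
  shows "g = id"
proof
  fix p
  have g: "g permutes V" using gp_R_even[OF assms(1)] by auto
  have T: "g (T s j) = T s j" for s j
    by (rule gp_fix[OF assms(1)]) (auto simp: R_simps)
  have pow: "g ((rot ^^ m) (F 1)) = (rot ^^ m) (F 1)" for m
  proof (induction m)
    case (Suc m)
    have "g (rot q) = rot (g q)" for q using assms(3) by (metis comp_apply)
    then show ?case using Suc by simp
  qed (use assms in simp)
  have "g (F x) = F x" if "1 \<le> x" "x \<le> M" for x
    using rot_orbit[OF that] pow by metis
  then show "g p = id p" using T permutes_not_in[OF g, of p] by (cases p; force)
qed

lemma dihedral_stabiliser:
  assumes g: "g \<in> gp (R ` {0, 1})" and fix1: "g (F 1) = F 1"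
  shows "g = id \<or> g = R 1"
proof (cases "rot \<circ> g = g \<circ> rot")
  case True
  then show ?thesis using dihedral_fix assms by blast
next
  case False
  then have "rot \<circ> g = g \<circ> rot'" "rot' \<circ> g = g \<circ> rot" using dihedral_conj[OF g] by auto
  \<comment> \<open>\<open>R 1\<close> fixes \<open>F 1\<close> and inverts \<open>rot\<close>, so
    composing with it leads back to \<open>dihedral_fix\<close>.\<close>
  then have "rot \<circ> (R 1 \<circ> g) = (R 1 \<circ> g) \<circ> rot"
    using rot_rot'(2) by (metis comp_assoc)
  moreover have "R 1 \<circ> g \<in> gp (R ` {0, 1})" using g by (auto intro: gp_step)
  moreover have "(R 1 \<circ> g) (F 1) = F 1" using fix1 by (simp add: R_simps)
  ultimately have "R 1 \<circ> g = id" by (intro dihedral_fix)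
  then have "g = R 1" by (metis R_R comp_apply ext id_apply)
  then show ?thesis ..
qed

lemma inter_0:
  assumes "g \<in> gp (R ` {..0})" "g \<in> gp (R ` {1..<e + 4})"
  shows "g = id"
proof -
  have "g (F 1) = F 1"
  proof (rule gp_fix[OF assms(2)])
    fix s assume "s \<in> R ` {1..<e + 4}"
    then obtain k where "s = R k" "1 \<le> k" by auto
    then show "s (F 1) = F 1" using R_front_fixed[of k 1] M(1) by (cases "k = 1") (auto simp: R_simps)
  qed
  moreover have "g = id \<or> g = R 0"
    using gp_singleton[of g "R 0"] assms(1) by (auto simp: R_R fun_eq_iff)
  moreover have "R 0 (F 1) = F 2" using M(1) by (simp add: R_simps)
  ultimately show ?thesis by auto
qed

lemma inter_1:
  assumes "g \<in> gp (R ` {..1})" "g \<in> gp (R ` {i..<e + 4})" "i \<in> {1, 2}"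
  shows "g \<in> gp (R ` {i..1})"
proof -
  have "{..1::nat} = {0, 1}" by auto
  then have g: "g \<in> gp (R ` {0, 1})" using assms(1) by simp
  have "g (F 1) = F 1"
  proof (rule gp_fix[OF assms(2)])
    fix s assume "s \<in> R ` {i..<e + 4}"
    then obtain k where "s = R k" "1 \<le> k" using assms(3) by auto
    then show "s (F 1) = F 1" using R_front_fixed[of k 1] M(1) by (cases "k = 1") (auto simp: R_simps)
  qed
  then have gR: "g = id \<or> g = R 1" using dihedral_stabiliser g by blast
  show ?thesis
  proof (cases "i = 1")
    case True
    then show ?thesis using gR by (auto intro: gp_id gp_gen)
  next
    case False
    \<comment> \<open>Without \<open>R 1\<close> the available generators fix \<open>F 2\<close>
      too, which excludes \<open>g = R 1\<close>.\<close>
    have "g (F 2) = F 2"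
    proof (rule gp_fix[OF assms(2)])
      fix s assume "s \<in> R ` {i..<e + 4}"
      then obtain k where "s = R k" "2 \<le> k" using assms(3) False by auto
      then show "s (F 2) = F 2" using R_front_fixed[of k 2] M(1) by auto
    qed
    moreover have "R 1 (F 2) = F 3" using M(1) by (simp add: R_simps)
    ultimately show ?thesis using gR by (auto intro: gp_id)
  qed
qed


section \<open>Alternating groups on a final segment of the path and an initial segment of the tails\<close>

text \<open>The tail vertices that the generators 2 to \<open>j\<close> connect to
  \<open>F M\<close>. \<open>R e\<close> exchanges sides only from index \<open>e + 2\<close> on,
  which the y side reaches when \<open>j \<ge> e + 1\<close>; from then on the z side is connected.
  Index \<open>e + 5\<close> hangs on \<open>e + 4\<close> by \<open>R (e + 2)\<close>, so it needs
  \<open>j = e + 3\<close>.\<close>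

definition tail :: "nat \<Rightarrow> pt set" where
  "tail j = {T s k | s k. 3 \<le> k \<and> k \<le> e + 5 \<and> (k \<le> j + 1 \<or> j = e + 3) \<and> (s \<longrightarrow> e < j)}"

lemma tail_iff [simp]:
  "F x \<notin> tail j" "T s k \<in> tail j \<longleftrightarrow> 3 \<le> k \<and> k \<le> e + 5 \<and> (k \<le> j + 1 \<or> j = e + 3) \<and> (s \<longrightarrow> e < j)"
  by (auto simp: tail_def)

lemma tr_up: "tr k k = Suc k" "k \<noteq> e + 4 \<Longrightarrow> tr k (Suc k) = k"
  by (auto simp: tr_def transpose_def)

lemma R_fix_low: "4 \<le> k \<Longrightarrow> R k (T False 3) = T False 3"
  using e by (auto simp: R_simps sw_def tr_def transpose_def)

text \<open>The two generators overlap only in \<open>T False 3\<close>, which gives a 3-cycle;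
  their other transpositions are disjoint and vanish in the square.\<close>

lemma R2_R3_sq: "(R 2 \<circ> R 3) \<circ> (R 2 \<circ> R 3) = cyc3 (F M) (T False 4) (T False 3)"
proof
  fix p
  have tr3: "tr 3 x = (if x = 3 then 4 else if x = 4 then 3 else x)" "\<not> sw 3 x" for x
    using e by (auto simp: tr_def sw_def transpose_def)
  show "((R 2 \<circ> R 3) \<circ> (R 2 \<circ> R 3)) p = cyc3 (F M) (T False 4) (T False 3) p"
    using M(1) by (cases p) (auto simp: R_simps tr3 transpose_def)
qed

text \<open>The conditions on \<open>c\<close> provide the front generators needed to walk from
  \<open>F M\<close> down to \<open>F c\<close>: \<open>R 1\<close> for the first step,
  \<open>R 0\<close> and \<open>R 1\<close> beyond it.\<close>

lemma alt_in_segment: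
  assumes A: "{2..j} \<subseteq> A" and j: "3 \<le> j" "j < e + 4"
    and c: "1 \<le> c" "c \<le> M" "c < M \<Longrightarrow> 1 \<in> A" "c < M - 1 \<Longrightarrow> 0 \<in> A"
  shows "alt_in (R ` A) (F ` {c..M} \<union> tail j)"
proof -
  let ?S = "R ` A" and ?P = "F ` {c..M} \<union> tail j"
  let ?Y0 = "{F M, T False 4, T False 3}"
  have gen: "R k \<in> gp ?S" if "k \<in> A" for k using that by (auto intro: gp_gen)
  have in_A: "k \<in> A" if "2 \<le> k" "k \<le> j" for k using that A by auto
  have "(R 2 \<circ> R 3) \<circ> (R 2 \<circ> R 3) \<in> gp ?S"
    using A j by (intro gp_comp gen) auto
  then have alt0: "alt_in ?S ?Y0" by (intro alt_in_cyc3) (auto simp: R2_R3_sq)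
  have sub: "?Y0 \<subseteq> ?P" using c j e by auto
  have "?P \<subseteq> V" using c by (auto simp: tail_def)
  then have fin: "finite ?P" using finite_V finite_subset by blast
  obtain Y where Y0: "?Y0 \<subseteq> Y" and YP: "Y \<subseteq> ?P" and alt: "alt_in ?S Y"
    and grow: "\<And>g x a b. g \<in> gp ?S \<Longrightarrow> x \<in> Y \<Longrightarrow> a \<in> Y \<Longrightarrow> b \<in> Y \<Longrightarrow> a \<noteq> b \<Longrightarrow> a \<noteq> x \<Longrightarrow> b \<noteq> x
      \<Longrightarrow> g a \<in> Y \<Longrightarrow> g b \<in> Y \<Longrightarrow> g x \<in> ?P \<Longrightarrow> g x \<in> Y"
    by (rule alt_in_maximal[OF fin sub alt0 involutive_R]) blast
  \<comment> \<open>Of the two points that must stay in \<open>Y\<close>, \<open>F M\<close> is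
    fixed and \<open>T False 3\<close> is fixed or, for \<open>k = 3\<close>, goes to
    \<open>T False 4\<close>. In \<open>front_step\<close> the two points are tail vertices fixed by
    the generator.\<close>
  have tail_step: "R k x \<in> Y" if k: "3 \<le> k" "k \<in> A" and x: "x \<in> Y" "x \<noteq> F M" "x \<noteq> T False 3"
    and "R k x \<in> ?P" for k x
  proof (rule grow[OF gen[OF k(2)] x(1), of "F M" "T False 3"])
    have "R 3 (T False 3) = T False 4" using e by (simp add: R_simps tr_def sw_def)
    then show "R k (T False 3) \<in> Y" using Y0 R_fix_low[of k] k by (cases "k = 3") auto
    show "R k (F M) \<in> Y" using Y0 k by (simp add: R_simps)
  qed (use that Y0 in auto)
  have front_step: "R k x \<in> Y" if "k \<in> A" "k \<le> 1" "x \<in> Y" "x \<in> range F" "R k x \<in> ?P" for k x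
    by (rule grow[OF gen, of k x "T False 3" "T False 4"])
       (use that Y0 in \<open>auto simp: R_simps le_Suc_eq\<close>)
  have up: "T s (k + 1) \<in> Y"
    if "T s k \<in> Y" "(s, k) \<noteq> (False, 3)" "3 \<le> k" "k \<le> j" "T s (k + 1) \<in> ?P" for s k
  proof -
    have "R k (T s k) = T s (k + 1)" using that by (simp add: R_simps tr_up sw_def)
    moreover have "k \<in> A" using that A by auto
    ultimately show ?thesis using tail_step[of k "T s k"] that by auto
  qed
  have y: "T False k \<in> Y" if "3 \<le> k" "k \<le> j + 1" for k
    using that
  proof (induction k rule: dec_induct)
    case (step k)
    show ?case
    proof (cases "k = 3")
      case False
      then have "T False k \<in> Y" using step by auto
      then show ?thesis using up[of False k] step False j by auto
    qed (use Y0 in auto)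
  qed (use Y0 in auto)
  have z: "T True k \<in> Y" if "3 \<le> k" "k \<le> j + 1" "e < j" for k
  proof -
    \<comment> \<open>The z side is entered at index \<open>e + 2\<close> through \<open>R e\<close>
      and then followed downwards and upwards.\<close>
    have top: "T True (e + 2) \<in> Y"
    proof -
      have "R e (T False (e + 2)) = T True (e + 2)" using e by (simp add: R_simps tr_def sw_def)
      then show ?thesis using tail_step[of e "T False (e + 2)"] y[of "e + 2"] in_A[of e] that e j by auto
    qed
    show ?thesis
    proof (cases "k \<le> e + 2")
      case True
      then show ?thesis using that(1)
      proof (induction k rule: inc_induct)
        case (step k)
        then have "R k (T True (k + 1)) = T True k" by (simp add: R_simps tr_up sw_def)
        then show ?case using tail_step[of k "T True (k + 1)"] in_A[of k] step that j by auto
      qed (use top in simp)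
    next
      case False
      then have "e + 2 \<le> k" by simp
      then show ?thesis using that(2)
      proof (induction k rule: dec_induct)
        case (step k)
        then show ?case using up[of True k] that(3) e j by auto
      qed (use top in simp)
    qed
  qed
  have last: "T s (e + 5) \<in> Y" if "j = e + 3" "T s (e + 5) \<in> ?P" for s
  proof -
    have "T s (e + 4) \<in> Y" using y[of "e + 4"] z[of "e + 4"] that by (cases s) auto
    moreover have "R (e + 2) (T s (e + 4)) = T s (e + 5)" using e by (simp add: R_simps tr_def sw_def)
    moreover have "e + 2 \<in> A" using A that by auto
    ultimately show ?thesis using tail_step[of "e + 2" "T s (e + 4)"] that e by auto
  qed
  have front: "F x \<in> Y" if "c \<le> x" "x \<le> M" for x
    using that(2,1)
  proof (induction x rule: inc_induct)
    case (step x)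
    show ?case
    proof (cases "even x")
      case True
      then have "R 1 (F (Suc x)) = F x" "1 \<in> A" using step c by (auto simp: R_simps)
      then show ?thesis using front_step[of 1 "F (Suc x)"] step by auto
    next
      case False
      then have "Suc x < M" using odd_less step by auto
      then have "R 0 (F (Suc x)) = F x" "0 \<in> A" using step c False by (auto simp: R_simps)
      then show ?thesis using front_step[of 0 "F (Suc x)"] step by auto
    qed
  qed (use Y0 in auto)
  have "?P \<subseteq> Y"
  proof
    fix p assume p: "p \<in> ?P"
    show "p \<in> Y"
    proof (cases p)
      case (F x)
      then show ?thesis using p front by auto
    next
      case (T s k)
      then show ?thesis using p y[of k] z[of k] last[of s] j
        by (cases s; cases "k = e + 5") auto
    qed
  qed
  then show ?thesis using alt_in_mono alt by blast
qed

lemma gp_R_all: "gp (R ` {..<e + 4}) = {g. g permutes V \<and> evenperm g}"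
proof -
  have "alt_in (R ` {..<e + 4}) (F ` {1..M} \<union> tail (e + 3))"
    by (rule alt_in_segment) (use M e in auto)
  moreover have "F ` {1..M} \<union> tail (e + 3) = V" by (auto simp: tail_def V_def)
  ultimately show ?thesis using gp_R_even by (auto simp: alt_in_def)
qed

lemma R1_R2_apply:
  "(R 1 \<circ> R 2) (F 2) = F 3" "(R 1 \<circ> R 2) (F 3) = F 5" "(R 1 \<circ> R 2) (F 4) = F 2" "(R 1 \<circ> R 2) (F 5) = F 4"
  "(R 1 \<circ> R 2) (F (M - 1)) = F M" "(R 1 \<circ> R 2) (F M) = T False 3" "(R 1 \<circ> R 2) (T False 3) = F (M - 1)"
  "x < 2 \<or> M < x \<Longrightarrow> (R 1 \<circ> R 2) (F x) = F x"
  "6 \<le> x \<Longrightarrow> x < M \<Longrightarrow> (R 1 \<circ> R 2) (F x) = F (if even x then x + 1 else x - 1)"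
  "s \<or> j \<noteq> 3 \<Longrightarrow> (R 1 \<circ> R 2) (T s j) = T s j"
  using M(1) M_odd by (auto simp: R_simps)

text \<open>\<open>R 1 \<circ> R 2\<close> consists of the 4-cycle 2, 3, 5, 4, a 3-cycle at the end
  of the path and transpositions in between; the fourth power leaves exactly the 3-cycle.\<close>

lemma R1_R2_4: "((R 1 \<circ> R 2) ^^ 4) = cyc3 (F M) (T False 3) (F (M - 1))"
proof
  fix p
  define q where "q = R 1 \<circ> R 2"
  note q = R1_R2_apply[folded q_def]
  have 4: "(q ^^ 4) x = q (q (q (q x)))" for x by (simp add: numeral_eq_Suc)
  have c: "cyc3 (F M) (T False 3) (F (M - 1)) p
    = (if p = F M then T False 3 else if p = T False 3 then F (M - 1) else if p = F (M - 1) then F M else p)"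
    using M(1) by (auto simp: transpose_def)
  show "((R 1 \<circ> R 2) ^^ 4) p = cyc3 (F M) (T False 3) (F (M - 1)) p"
    unfolding q_def[symmetric] 4 c
  proof (cases p)
    case (F x)
    consider "x = 2 \<or> x = 3 \<or> x = 4 \<or> x = 5" | "x = M - 1" | "x = M" | "x < 2 \<or> M < x"
      | "6 \<le> x" "x < M - 1" "even x" | "6 \<le> x" "x < M - 1" "odd x" by linarith
    then show "q (q (q (q p))) = (if p = F M then T False 3 else if p = T False 3 then F (M - 1) else if p = F (M - 1) then F M else p)"
    proof cases
      case 1
      then show ?thesis using F q(1-4) M(1) by auto
    next
      case 5
      then have "Suc x < M" by simp
      then have "q (F x) = F (x + 1)" "q (F (x + 1)) = F x" using 5 by (auto simp: q(9))
      then show ?thesis using F 5 by simp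
    next
      case 6
      then have "6 < x" by (cases "x = 6") auto
      then have "q (F x) = F (x - 1)" "q (F (x - 1)) = F x" using 6 by (auto simp: q(9))
      then show ?thesis using F 6 by simp
    qed (use F q(5-8) M(1) in auto)
  next
    case (T s j)
    then show "q (q (q (q p))) = (if p = F M then T False 3 else if p = T False 3 then F (M - 1) else if p = F (M - 1) then F M else p)"
      using q(5-7) q(10)[of s j] by auto
  qed
qed

lemma gp_pow: "g \<in> gp S \<Longrightarrow> g ^^ n \<in> gp S"
  by (induction n) (auto intro: gp_id gp_comp)

section \<open>The intersection condition for i = 1 and i = 2\<close>

text \<open>For \<open>j < e + 3\<close> this contains exactly the tail vertices outside
  \<open>tail j\<close>. Of the generators up to \<open>j\<close> only those from 3 on can move its
  points.\<close>

definition tail_rest :: "nat \<Rightarrow> pt set" where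
  "tail_rest j = {T s k | s k. j + 2 \<le> k \<or> (s \<and> j \<le> e)}"

lemma tail_rest_iff [simp]: "F x \<notin> tail_rest j" "T s k \<in> tail_rest j \<longleftrightarrow> j + 2 \<le> k \<or> (s \<and> j \<le> e)"
  by (auto simp: tail_rest_def)

lemma R_tail_rest:
  assumes "k \<le> j" "2 \<le> j" "j < e + 3" "p \<in> tail_rest j"
  shows "R k p \<in> tail_rest j" "k < 3 \<Longrightarrow> R k p = p"
proof -
  obtain s l where p: "p = T s l" "j + 2 \<le> l \<or> (s \<and> j \<le> e)" using assms by (cases p) auto
  show *: "R k p = p" if "k < 3"
  proof -
    have "k = 0 \<or> k = 1 \<or> k = 2" using that by auto
    then show ?thesis using p assms by (auto simp: R_simps)
  qed
  show "R k p \<in> tail_rest j"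
  proof (cases "k < 3")
    case True
    then show ?thesis using * assms by auto
  next
    case False
    have "j + 2 \<le> l \<Longrightarrow> j + 2 \<le> tr k l" using assms by (auto simp: tr_def transpose_def)
    \<comment> \<open>Sides are exchanged only from index \<open>e + 2\<close> on, and for
      \<open>j \<le> e\<close> both sides belong to the set there.\<close>
    moreover have "j + 2 \<le> l" if "sw k l" "j \<le> e" using that assms by (auto simp: sw_def)
    ultimately show ?thesis using p False by (auto simp: R_simps)
  qed
qed

text \<open>Multiplication by h trivialises g on the path, multiplication by t on the part of the tails that the
  first j + 1 generators do not connect to the path; what remains is an even permutation of the segment.\<close>

lemma inter_front:
  assumes g: "g \<in> gp (R ` {..j})" "g \<in> gp (R ` {i..<e + 4})" and i: "i = 1 \<or> i = 2" and j: "2 \<le> j" "j < e + 3"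
  shows "g \<in> gp (R ` {i..j})"
proof -
  let ?Z = "F ` {..<M - 1}"
  have ev: "even (M - 1)" using M_odd by simp
  \<comment> \<open>The path is left only at \<open>F M\<close>, whose partner under
    \<open>R 1\<close> is \<open>F (M - 1)\<close>. So the vertices below \<open>M - 1\<close> are
    kept by all generators from 1 on, and only \<open>R 1\<close> and \<open>R 2\<close> act on
    them.\<close>
  obtain h where h: "h \<in> gp (R ` {i..2})" "\<And>z. z \<in> ?Z \<Longrightarrow> h (g z) = z"
  proof (rule gp_restrict[OF g(2), of ?Z "R ` {i..2}"])
    fix s z assume s: "s \<in> R ` {i..<e + 4}" and z: "z \<in> ?Z"
    obtain x where x: "z = F x" "x < M - 1" using z by auto
    obtain k where k: "s = R k" "1 \<le> k" "i \<le> k" using s i by auto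
    have "Suc x < M - 1" if "even x" using that x ev by presburger
    then have R1: "R 1 z \<in> ?Z" using x by (auto simp: R_simps)
    have R2: "R 2 z \<in> ?Z" using x M(1) by (auto simp: R_simps)
    consider "k = 1" | "k = 2" | "3 \<le> k" using k by linarith
    then show "s z \<in> ?Z" using R1 R2 k z x by cases (auto simp: R_simps)
    show "s z = z" if "s \<notin> R ` {i..2}"
    proof -
      have "\<not> (i \<le> k \<and> k \<le> 2)" using that k by auto
      then have "3 \<le> k" using k by linarith
      then show ?thesis using k x by (simp add: R_simps)
    qed
  qed (use involutive_R in auto)
  have hj: "h \<in> gp (R ` {..j})" "h \<in> gp (R ` {i..<e + 4})" "h \<in> gp (R ` {i..j})"
    using h(1) j by (auto elim!: gp_mono)
  have hg: "h \<circ> g \<in> gp (R ` {..j})" using g hj gp_comp by blast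
  obtain t where t: "t \<in> gp (R ` {3..j})" "\<And>z. z \<in> tail_rest j \<Longrightarrow> t ((h \<circ> g) z) = z"
  proof (rule gp_restrict[OF hg, of "tail_rest j" "R ` {3..j}"])
    fix s z assume s: "s \<in> R ` {..j}" and z: "z \<in> tail_rest j"
    obtain k where k: "s = R k" "k \<le> j" using s by auto
    show "s z \<in> tail_rest j" using R_tail_rest(1) k j z by auto
    show "s z = z" if "s \<notin> R ` {3..j}"
    proof -
      have "k < 3" using that k by fastforce
      then show ?thesis using R_tail_rest(2) k j z by auto
    qed
  qed (use involutive_R in auto)
  have tj: "t \<in> gp (R ` {..j})" "t \<in> gp (R ` {i..<e + 4})" "t \<in> gp (R ` {i..j})"
    using t(1) j i by (auto elim!: gp_mono)
  have tF: "t (F x) = F x" for x by (rule gp_fix[OF t(1)]) (auto simp: R_simps)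
  define g' where "g' = t \<circ> (h \<circ> g)"
  have g': "g' \<in> gp (R ` {..j})" "g' \<in> gp (R ` {i..<e + 4})"
    unfolding g'_def using g hj tj by (auto intro!: gp_comp)
  have perm: "g' permutes V" "evenperm g'" 
  proof -
    have "{..j} \<subseteq> {..<e + 4}" using j by auto
    then show "g' permutes V" "evenperm g'" using gp_R_even[OF g'(1)] by blast+
  qed
  \<comment> \<open>For i = 1 the segment starts at \<open>M - 1\<close>. For i = 2 all available
    generators fix \<open>F (M - 1)\<close>, and it starts at \<open>M\<close>.\<close>
  define c where "c = M - (2 - i)"
  have c: "c = (if i = 1 then M - 1 else M)" using i by (auto simp: c_def)
  let ?P = "F ` {c..M} \<union> tail j"
  have "g' p = p" if p: "p \<in> V - ?P" for p
  proof (cases p)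
    case (F x)
    then consider "x < M - 1" | "x = M - 1" "i = 2" using p i c by fastforce
    then show ?thesis
    proof cases
      case 1
      then show ?thesis using F h(2)[of p] tF by (simp add: g'_def)
    next
      case 2
      show ?thesis unfolding F
      proof (rule gp_fix[OF g'(2)])
        fix s assume "s \<in> R ` {i..<e + 4}"
        then obtain k where "s = R k" "2 \<le> k" using 2 by auto
        moreover have "x \<notin> {3, 4, M}" using 2 M(1) by force
        ultimately show "s (F x) = F x" using R_front_fixed[of k x] by blast
      qed
    qed
  next
    case (T s k)
    then have "p \<in> tail_rest j" using p j by auto
    then show ?thesis using t(2) by (simp add: g'_def)
  qed
  then have g'P: "g' permutes ?P" using permutes_superset[OF perm(1), of ?P] by auto
  have "g' \<in> gp (R ` {i..j})"
  proof (cases "j = 2")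
    case False
    have "alt_in (R ` {i..j}) ?P"
      by (rule alt_in_segment) (use False i j M c in auto)
    then show ?thesis using g'P perm by (simp add: alt_in_def)
  next
    case True
    have tail2: "tail 2 = {T False 3}" using e by (auto simp: tail_def)
    show ?thesis
    proof (cases "i = 1")
      case True
      have "F ` {c..M} = {F (M - 1), F M}" using c True M(1) by auto
      then have P: "?P = {F M, T False 3, F (M - 1)}" using tail2 \<open>j = 2\<close> by auto
      have "(R 1 \<circ> R 2) ^^ 4 \<in> gp (R ` {i..j})"
        using True \<open>j = 2\<close> by (intro gp_pow gp_comp gp_gen) auto
      then have "cyc3 (F M) (T False 3) (F (M - 1)) \<in> gp (R ` {i..j})" by (simp only: R1_R2_4)
      then have "alt_in (R ` {i..j}) ?P"
        unfolding P by (rule alt_in_cyc3) (use M(1) in auto)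
      then show ?thesis using g'P perm by (simp add: alt_in_def)
    next
      case False
      then have "?P = {F M, T False 3}" using tail2 \<open>j = 2\<close> c by auto
      then have "g' = id \<or> g' = transpose (F M) (T False 3)"
        using g'P by (simp add: permutes_doubleton_iff)
      then show ?thesis using perm(2) by (auto simp: evenperm_swap gp_id)
    qed
  qed
  then have "h \<circ> g \<in> gp (R ` {i..j})"
    unfolding g'_def using gp_cancel_left tj(3) involutive_R by blast
  then show ?thesis using gp_cancel_left hj(3) involutive_R by blast
qed

end

section \<open>The intersection condition on the tails\<close>

text \<open>The property \<open>P\<close> is kept general because it is used twice: for membership
  of a plain index permutation (\<open>diagonal_gp\<close>) and for the existence of some choice of
  signs (\<open>diagonal_lift\<close>).\<close>

lemma adjacent_transpositions:
  fixes i m :: nat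
  assumes \<pi>: "\<pi> permutes {i..m}" and "P id" and comp: "\<And>\<sigma> \<tau>. P \<sigma> \<Longrightarrow> P \<tau> \<Longrightarrow> P (\<sigma> \<circ> \<tau>)"
    and adj: "\<And>k. i \<le> k \<Longrightarrow> k < m \<Longrightarrow> P (transpose k (Suc k))"
  shows "P \<pi>"
proof -
  have less: "P (transpose a b)" if "i \<le> a" "Suc a \<le> b" "b \<le> m" for a b
    using that(2,3)
  proof (induction b rule: dec_induct)
    case base
    then show ?case using adj that by auto
  next
    case (step b)
    have "transpose a (Suc b) = transpose b (Suc b) \<circ> (transpose a b \<circ> transpose b (Suc b))"
      using step by (auto simp: fun_eq_iff transpose_def)
    moreover have b: "P (transpose b (Suc b))" using adj step that by auto
    have "P (transpose a b)" using step by auto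
    then have "P (transpose b (Suc b) \<circ> (transpose a b \<circ> transpose b (Suc b)))"
      by (intro comp b)
    ultimately show ?case by (simp only:)
  qed
  have swap: "P (transpose a b)" if "a \<in> {i..m}" "b \<in> {i..m}" "a \<noteq> b" for a b
    using less[of a b] less[of b a] that by (cases "a < b") (auto simp: transpose_commute)
  show ?thesis
  proof (rule permutes_induct[OF \<pi>])
    show "P (transpose a b \<circ> p)" if "a \<in> {i..m}" "b \<in> {i..m}" "a \<noteq> b" "P p" for a b p
      by (rule comp[OF swap]) (use that in auto)
  qed (rule finite_atLeastAtMost, rule \<open>P id\<close>)
qed

lemma W_eq_iff: "W \<pi> a = W \<sigma> b \<longleftrightarrow> \<pi> = \<sigma> \<and> a = b"
proof
  assume *: "W \<pi> a = W \<sigma> b"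
  have "\<pi> k = \<sigma> k \<and> a k = b k" for k
    using fun_cong[OF *, of "T False k"] by simp
  then show "\<pi> = \<sigma> \<and> a = b" by auto
qed simp

lemma W_D_comp: "W \<pi> (\<lambda>_. False) \<circ> W \<sigma> (\<lambda>_. False) = W (\<pi> \<circ> \<sigma>) (\<lambda>_. False)"
  by (simp add: W_comp)

context pt_graph
begin

section \<open>Splitting signs and transpositions off the tail generators\<close>

lemma tr_perm: "i \<le> k \<Longrightarrow> k < e + 4 \<Longrightarrow> tr k permutes {i..e + 5}"
  unfolding tr_def by (auto intro!: permutes_compose permutes_swap_id)

lemma sw_iff: "sw k j \<longleftrightarrow> k = e \<and> Suc (Suc e) \<le> j \<and> j \<le> e + 5"
  by (auto simp: sw_def)

lemma sw_False: "k \<noteq> e \<Longrightarrow> sw k = (\<lambda>_. False)" and sw_e: "sw e = (\<lambda>l. e + 2 \<le> l \<and> l \<le> e + 5)"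
  by (auto simp: sw_def fun_eq_iff)

lemma tr_eqs:
  "k \<noteq> Suc (Suc e) \<Longrightarrow> tr k l = (if l = k then Suc k else if l = Suc k then k else l)"
  "tr (Suc (Suc e)) l = (if l = Suc (Suc e) then e + 3 else if l = e + 3 then Suc (Suc e)
     else if l = e + 4 then e + 5 else if l = e + 5 then e + 4 else l)"
  by (auto simp: tr_def transpose_def)

lemma funpow3: "(f ^^ 3) x = f (f (f x))"
  by (simp add: numeral_3_eq_3)

text \<open>On the indices e - 1, e, e + 1 the product is a 3-cycle without signs, and on e + 2 to e
  + 5 it only exchanges sides; the cube keeps the exchange.\<close>

lemma cube_e_minus_1:
  assumes "Suc k = e"
  shows "(R k \<circ> R e) ^^ 3 = W id (\<lambda>l. e + 2 \<le> l \<and> l \<le> e + 5)"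
proof
  fix p
  have k: "3 \<le> k" "3 \<le> e" "k \<noteq> Suc (Suc e)" "k \<noteq> e" using assms e by auto
  have tk: "tr k l = (if l = k then e else if l = e then k else l)" for l
    using tr_eqs(1)[OF k(3)] assms by simp
  show "((R k \<circ> R e) ^^ 3) p = W id (\<lambda>l. e + 2 \<le> l \<and> l \<le> e + 5) p"
  proof (cases p)
    case (T s l)
    consider "l = k" | "l = e" | "l = Suc e" | "l < k" | "Suc (Suc e) \<le> l" using assms by linarith
    then show ?thesis unfolding funpow3
      using T k assms by cases (auto simp: R_simps(8)[OF k(1)] R_simps(8)[OF k(2)] tk tr_eqs(1) sw_iff)
  qed (simp add: funpow3 R_simps(4)[OF k(1)] R_simps(4)[OF k(2)])
qed

text \<open>A full turn through e, e + 1, e + 2 changes the side once, so the cube exchanges sides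
  on these three indices as well as on the last three.\<close>

lemma cube_e: "(R e \<circ> R (Suc e)) ^^ 3 = W id (\<lambda>l. e \<le> l \<and> l \<le> e + 5)"
proof
  fix p
  have k: "3 \<le> Suc e" "3 \<le> e" using e by auto
  show "((R e \<circ> R (Suc e)) ^^ 3) p = W id (\<lambda>l. e \<le> l \<and> l \<le> e + 5) p"
  proof (cases p)
    case (T s l)
    consider "l = e" | "l = Suc e" | "l = Suc (Suc e)" | "l < e" | "e + 3 \<le> l" by linarith
    then show ?thesis unfolding funpow3
      using T by cases (auto simp: R_simps(8)[OF k(1)] R_simps(8)[OF k(2)] tr_eqs sw_iff)
  qed (simp add: funpow3 R_simps(4)[OF k(1)] R_simps(4)[OF k(2)])
qed

text \<open>A 3-cycle on e + 1, e + 2, e + 3 and a disjoint transposition: the cube isolates the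
  transposition.\<close>

lemma cube_e_plus_1: "(R (Suc e) \<circ> R (Suc (Suc e))) ^^ 3 = W (transpose (e + 4) (e + 5)) (\<lambda>_. False)"
proof
  fix p
  have k: "3 \<le> Suc e" "3 \<le> Suc (Suc e)" using e by auto
  show "((R (Suc e) \<circ> R (Suc (Suc e))) ^^ 3) p = W (transpose (e + 4) (e + 5)) (\<lambda>_. False) p"
  proof (cases p)
    case (T s l)
    consider "l = Suc e" | "l = Suc (Suc e)" | "l = e + 3" | "l = e + 4" | "l = e + 5" | "l < Suc e" | "e + 5 < l" by linarith
    then show ?thesis unfolding funpow3
      using T by cases (auto simp: R_simps(8)[OF k(1)] R_simps(8)[OF k(2)] tr_eqs sw_iff transpose_def)
  qed (simp add: funpow3 R_simps(4)[OF k(1)] R_simps(4)[OF k(2)])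
qed

lemma D45_gp: "{Suc e, Suc (Suc e)} \<subseteq> A \<Longrightarrow> W (transpose (e + 4) (e + 5)) (\<lambda>_. False) \<in> gp (R ` A)"
  unfolding cube_e_plus_1[symmetric] by (intro gp_pow gp_comp gp_gen) auto

lemma E6_gp: "{e, Suc e} \<subseteq> A \<Longrightarrow> W id (\<lambda>l. e \<le> l \<and> l \<le> e + 5) \<in> gp (R ` A)"
  unfolding cube_e[symmetric] by (intro gp_pow gp_comp gp_gen) auto

lemma E4_gp: "{e - 1, e} \<subseteq> A \<Longrightarrow> W id (\<lambda>l. e + 2 \<le> l \<and> l \<le> e + 5) \<in> gp (R ` A)"
  using cube_e_minus_1[of "e - 1"] e
    gp_pow[OF gp_comp[OF gp_gen gp_gen], of "R (e - 1)" "R ` A" "R e" 3] by simp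

lemma R_plain: "3 \<le> k \<Longrightarrow> k \<noteq> e \<Longrightarrow> k \<noteq> e + 2 \<Longrightarrow> R k = W (transpose k (Suc k)) (\<lambda>_. False)"
  by (simp add: R_W tr_def sw_False)

text \<open>The cube of R (e + 1) R (e + 2) cancels the second of the two transpositions in R (e + 2).\<close>

lemma D23_gp:
  assumes "{Suc e, Suc (Suc e)} \<subseteq> A"
  shows "W (transpose (e + 2) (e + 3)) (\<lambda>_. False) \<in> gp (R ` A)"
proof -
  have "R (Suc (Suc e)) \<circ> W (transpose (e + 4) (e + 5)) (\<lambda>_. False) \<in> gp (R ` A)"
    using assms by (intro gp_comp D45_gp gp_gen) auto
  moreover have "R (Suc (Suc e)) \<circ> W (transpose (e + 4) (e + 5)) (\<lambda>_. False) = W (transpose (e + 2) (e + 3)) (\<lambda>_. False)"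
    using e by (simp add: R_W W_D_comp sw_False tr_def comp_assoc)
  ultimately show ?thesis by simp
qed

text \<open>For \<open>i < e\<close> both irregular generators can be straightened:
  \<open>R e\<close> loses its signs through the cube with \<open>R (e - 1)\<close>, and
  \<open>R (e + 2)\<close> its second transposition through the cube with
  \<open>R (e + 1)\<close>.\<close>

lemma transposition_gp:
  assumes "{i..j} \<subseteq> A" "3 \<le> i" "i < e" "j < e + 3" "i \<le> k" "k \<le> j"
  shows "W (transpose k (Suc k)) (\<lambda>_. False) \<in> gp (R ` A)"
proof -
  consider "k \<noteq> e" "k \<noteq> e + 2" | "k = e" | "k = e + 2" by auto
  then show ?thesis
  proof cases
    case 1
    then show ?thesis using R_plain[of k] assms by (metis atLeastAtMost_iff gp_gen image_eqI order_trans subsetD)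
  next
    case 2
    have "{e - 1, e} \<subseteq> {i..j}" using assms 2 by auto
    then have "{e - 1, e} \<subseteq> A" using assms(1) by blast
    then have "R e \<circ> W id (\<lambda>l. e + 2 \<le> l \<and> l \<le> e + 5) \<in> gp (R ` A)"
      by (intro gp_comp E4_gp gp_gen) auto
    moreover have "R e \<circ> W id (\<lambda>l. e + 2 \<le> l \<and> l \<le> e + 5) = W (transpose k (Suc k)) (\<lambda>_. False)"
      using e 2 by (simp add: R_W W_comp sw_e tr_def)
    ultimately show ?thesis by simp
  next
    case 3
    have "{Suc e, Suc (Suc e)} \<subseteq> {i..j}" using assms 3 by auto
    then have "{Suc e, Suc (Suc e)} \<subseteq> A" using assms(1) by blast
    then show ?thesis using D23_gp[of A] 3 by (simp add: numeral_3_eq_3)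
  qed
qed

lemma diagonal_gp:
  assumes "\<pi> permutes {i..m}" "\<And>k. i \<le> k \<Longrightarrow> k < m \<Longrightarrow> W (transpose k (Suc k)) (\<lambda>_. False) \<in> gp S"
  shows "W \<pi> (\<lambda>_. False) \<in> gp S"
proof (rule adjacent_transpositions[OF assms(1), of "\<lambda>\<pi>. W \<pi> (\<lambda>_. False) \<in> gp S"])
  show "W (\<sigma> \<circ> \<tau>) (\<lambda>_. False) \<in> gp S"
    if "W \<sigma> (\<lambda>_. False) \<in> gp S" "W \<tau> (\<lambda>_. False) \<in> gp S" for \<sigma> \<tau>
    using gp_comp[OF that] by (simp add: W_D_comp)
qed (use assms(2) in \<open>auto simp: W_id gp_id\<close>)

text \<open>Meant for i = e, where \<open>R e\<close> cannot be freed of its signs: only the index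
  permutation is prescribed and the signs stay open.\<close>

lemma diagonal_lift:
  assumes "\<pi> permutes {i..m}" "\<And>k. i \<le> k \<Longrightarrow> k < m \<Longrightarrow> \<exists>b. W (transpose k (Suc k)) b \<in> gp S"
  shows "\<exists>b. W \<pi> b \<in> gp S"
proof (rule adjacent_transpositions[OF assms(1), of "\<lambda>\<pi>. \<exists>b. W \<pi> b \<in> gp S"])
  show "\<exists>b. W (\<sigma> \<circ> \<tau>) b \<in> gp S"
    if "\<exists>b. W \<sigma> b \<in> gp S" "\<exists>b. W \<tau> b \<in> gp S" for \<sigma> \<tau>
    using gp_comp that W_comp by metis
  show "\<exists>b. W id b \<in> gp S" using W_id gp_id by metis
qed (use assms(2) in auto)

lemma single_swap: "W id (\<lambda>l. l = m) = transpose (T False m) (T True m)"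
proof
  fix p show "W id (\<lambda>l. l = m) p = transpose (T False m) (T True m) p"
    by (cases p) (auto simp: transpose_def)
qed

text \<open>Exchanges of two adjacent sides remove all signs but at most one, and a single exchange is an odd permutation.\<close>

lemma even_signs:
  assumes a: "\<And>k. a k \<Longrightarrow> i \<le> k \<and> k \<le> m" and A: "A \<subseteq> {..<e + 4}"
    and pair: "\<And>k. i \<le> k \<Longrightarrow> k < m \<Longrightarrow> W id (\<lambda>l. l = k \<or> l = Suc k) \<in> gp (R ` A)"
    and g: "W id a \<in> gp (R ` {..<e + 4})"
  shows "W id a \<in> gp (R ` A)"
proof -
  have comp: "W id b \<circ> W id c = W id (\<lambda>l. b l \<noteq> c l)" for b c
    by (auto simp: W_comp W_eq_iff)
  show ?thesis
  proof (cases "i \<le> m")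
    case False
    then have "a = (\<lambda>_. False)" using a by fastforce
    then show ?thesis by (simp add: W_id gp_id)
  next
    case True
    have "\<exists>s\<in>gp (R ` A). \<exists>b. s \<circ> W id a = W id b \<and> (\<forall>k. b k \<longrightarrow> i + n \<le> k \<and> k \<le> m)" if "i + n \<le> m" for n
      using that
    proof (induction n)
      case 0
      then show ?case using a by (intro bexI[of _ id]) (auto intro: gp_id)
    next
      case (Suc n)
      have "i + n \<le> m" using Suc.prems by simp
      from Suc.IH[OF this] obtain s b where
        s: "s \<in> gp (R ` A)" "s \<circ> W id a = W id b" "\<forall>k. b k \<longrightarrow> i + n \<le> k \<and> k \<le> m"
        by blast
      show ?case
      proof (cases "b (i + n)")
        case False
        then have "i + Suc n \<le> k" if "b k" for k
          using s(3) that by (metis add_Suc_right le_antisym not_less_eq_eq)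
        then show ?thesis using s by blast
      next
        case True
        \<comment> \<open>Exchanging sides at i + n and its successor clears the sign at i + n and
          changes only the next one.\<close>
        let ?w = "W id (\<lambda>l. l = i + n \<or> l = Suc (i + n))"
        let ?b = "\<lambda>l. (l = i + n \<or> l = Suc (i + n)) \<noteq> b l"
        have "?w \<circ> s \<in> gp (R ` A)" using s(1) pair[of "i + n"] Suc.prems by (auto intro: gp_comp)
        moreover have "(?w \<circ> s) \<circ> W id a = W id ?b" using s(2) comp by (simp add: comp_assoc)
        moreover have "i + Suc n \<le> k \<and> k \<le> m" if "?b k" for k
          using s(3) that True Suc.prems by (cases "k = i + n"; cases "k = Suc (i + n)") force+
        ultimately show ?thesis by blast
      qed
    qed
    from this[of "m - i"] obtain s b where s: "s \<in> gp (R ` A)" "s \<circ> W id a = W id b" "\<forall>k. b k \<longrightarrow> k = m"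
      using True by fastforce
    have "s \<in> gp (R ` {..<e + 4})" using s(1) by (rule gp_mono) (use A in auto)
    then have "s \<circ> W id a \<in> gp (R ` {..<e + 4})" by (rule gp_comp[OF _ g])
    then have "evenperm (W id b)" unfolding s(2) using gp_R_even by blast
    moreover have "b = (\<lambda>l. l = m)" if "b m"
      by (rule ext) (use s(3) that in blast)
    ultimately have "\<not> b m" by (auto simp: single_swap evenperm_swap)
    then have "b = (\<lambda>_. False)" by (intro ext) (use s(3) in blast)
    then have "s \<circ> W id a \<in> gp (R ` A)" using s(2) by (simp add: W_id gp_id)
    then show ?thesis using gp_cancel_left s(1) involutive_R by blast
  qed
qed

text \<open>For i = e the index permutation determines the signs up to a global sign: R e changes the sign exactly
  on the indices other than e and e + 1, which it exchanges.\<close>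

definition tail_shape :: "nat \<Rightarrow> (nat \<Rightarrow> nat) \<Rightarrow> (nat \<Rightarrow> bool) \<Rightarrow> bool" where
  "tail_shape i \<pi> a \<longleftrightarrow> \<pi> permutes {i..e + 5} \<and> (\<forall>k. a k \<longrightarrow> i \<le> k \<and> k \<le> e + 5)
    \<and> (e < i \<longrightarrow> (\<forall>k. \<not> a k)) \<and> (i = e \<longrightarrow> (\<exists>c. \<forall>k\<in>{e..e + 5}. a k = (c \<noteq> ((k = e) \<noteq> (\<pi> k = e)))))"

lemma tail_form:
  assumes "3 \<le> i" "g \<in> gp (R ` {i..<e + 4})"
  shows "\<exists>\<pi> a. g = W \<pi> a \<and> tail_shape i \<pi> a"
  using assms(2)
proof (induction rule: gp.induct)
  case gp_id
  show ?case
  proof (intro exI conjI)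
    show "id = W id (\<lambda>_. False)" by (simp only: W_id)
    show "tail_shape i id (\<lambda>_. False)" unfolding tail_shape_def using permutes_id by fastforce
  qed
next
  case (gp_step s g)
  then obtain \<pi> a where gW: "g = W \<pi> a" and shape: "tail_shape i \<pi> a"
    by (elim exE conjE)
  have g: "g = W \<pi> a" "\<pi> permutes {i..e + 5}" "\<forall>k. a k \<longrightarrow> i \<le> k \<and> k \<le> e + 5"
    and no: "e < i \<Longrightarrow> \<not> a k" and c: "i = e \<Longrightarrow> \<exists>c. \<forall>k\<in>{e..e + 5}. a k = (c \<noteq> ((k = e) \<noteq> (\<pi> k = e)))" for k
    using gW shape[unfolded tail_shape_def] by simp_all
  obtain m where m: "s = R m" "i \<le> m" "m < e + 4" using gp_step by auto
  let ?a = "\<lambda>k. a k \<noteq> sw m (\<pi> k)"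
  have img: "\<pi> k \<in> {i..e + 5} \<longleftrightarrow> k \<in> {i..e + 5}" for k using g(2) permutes_in_image by metis
  have "s \<circ> g = W (tr m \<circ> \<pi>) ?a" using m g(1) assms by (simp add: R_W W_comp)
  moreover have "tr m \<circ> \<pi> permutes {i..e + 5}" using tr_perm m g by (blast intro: permutes_compose)
  moreover have "i \<le> k \<and> k \<le> e + 5" if "?a k" for k
  proof (cases "a k")
    case False
    then have "\<pi> k \<in> {i..e + 5}" using that m by (auto simp: sw_def)
    then show ?thesis using img by simp
  qed (use g in auto)
  moreover have "\<not> ?a k" if "e < i" for k using no[of k] that m by (auto simp: sw_def)
  moreover have "\<exists>c. \<forall>k\<in>{e..e + 5}. ?a k = (c \<noteq> ((k = e) \<noteq> ((tr m \<circ> \<pi>) k = e)))" if i: "i = e"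
  proof -
    obtain c where c: "\<forall>k\<in>{e..e + 5}. a k = (c \<noteq> ((k = e) \<noteq> (\<pi> k = e)))" using c i by blast
    \<comment> \<open>Composing with \<open>R e\<close> flips the constant. Where
      \<open>\<pi> k\<close> is e or e + 1, \<open>R e\<close> leaves the sign alone; there the
      truth value of \<open>\<pi> k = e\<close> flips as well and compensates.\<close>
    have "?a k = ((c \<noteq> (m = e)) \<noteq> ((k = e) \<noteq> ((tr m \<circ> \<pi>) k = e)))" if k: "k \<in> {e..e + 5}" for k
    proof (cases "m = e")
      case True
      have "\<pi> k \<in> {e..e + 5}" using img k i by blast
      then have "sw e (\<pi> k) \<longleftrightarrow> \<pi> k \<noteq> e \<and> \<pi> k \<noteq> Suc e" by (auto simp: sw_def)
      moreover have "tr e (\<pi> k) = e \<longleftrightarrow> \<pi> k = Suc e" by (auto simp: tr_eqs)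
      ultimately show ?thesis using True c k by auto
    next
      case False
      then have "tr m (\<pi> k) = e \<longleftrightarrow> \<pi> k = e" "\<not> sw m (\<pi> k)"
        using m i by (auto simp: tr_def sw_def transpose_def)
      then show ?thesis using False c k by auto
    qed
    then show ?thesis by blast
  qed
  ultimately have "tail_shape i (tr m \<circ> \<pi>) ?a" "s \<circ> g = W (tr m \<circ> \<pi>) ?a"
    unfolding tail_shape_def by simp_all
  then show ?case by (intro exI conjI)
qed


text \<open>Under the generators up to \<open>j\<close> the indices from \<open>j + 2\<close> on
  move only among themselves. Since \<open>i \<le> e\<close>, the generators below \<open>i\<close>
  act trivially there, so a word in the remaining ones undoes \<open>g\<close>.\<close>

lemma tail_trim:
  assumes "3 \<le> i" "i \<le> e" "i \<le> Suc j" "j < e + 3" "g \<in> gp (R ` {..j})"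
  obtains t where "t \<in> gp (R ` {i..j})" "\<And>s k. j + 2 \<le> k \<Longrightarrow> t (g (T s k)) = T s k"
proof -
  let ?Z = "{T s k | s k. j + 2 \<le> k}"
  obtain t where t: "t \<in> gp (R ` {i..j})" "\<And>z. z \<in> ?Z \<Longrightarrow> t (g z) = z"
  proof (rule gp_restrict[OF assms(5), of ?Z "R ` {i..j}"])
    fix s z assume "s \<in> R ` {..j}" and "z \<in> ?Z"
    then obtain k u l where k: "s = R k" "k \<le> j" and z: "z = T u l" "j + 2 \<le> l" by auto
    have up: "j + 2 \<le> tr k l" using k z assms by (auto simp: tr_def transpose_def)
    consider "k = 0" | "k = 1" | "k = 2" | "3 \<le> k" by linarith
    then show "s z \<in> ?Z" using k z up assms by cases (auto simp: R_simps)
    show "s z = z" if "s \<notin> R ` {i..j}"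
    proof -
      have "k < i" using that k by auto
      then have "tr k l = l" "\<not> sw k l" using k z assms by (auto simp: tr_def sw_def transpose_def)
      consider "k = 0" | "k = 1" | "k = 2" | "3 \<le> k" by linarith
      then show ?thesis using k z \<open>tr k l = l\<close> \<open>\<not> sw k l\<close> assms by cases (auto simp: R_simps)
    qed
  qed (use involutive_R in auto)
  then show thesis using that[of t] by blast
qed

text \<open>Sides are exchanged only from index \<open>e + 2\<close> on, and for
  \<open>j \<le> e\<close> the indices up to \<open>j + 1\<close> never mix with those. This rules
  out signs.\<close>

lemma side_kept:
  assumes "j \<le> e" "g \<in> gp (R ` {..j})" "3 \<le> k" "k \<le> j + 1"
  shows "\<exists>l. g (T True k) = T True l"
proof -
  let ?Z = "{T True k | k. k \<le> j + 1}"
  have "g (T True k) \<in> ?Z"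
  proof (rule gp_stable[OF assms(2)])
    fix s z assume "s \<in> R ` {..j}" and "z \<in> ?Z"
    then obtain k l where k: "s = R k" "k \<le> j" and z: "z = T True l" "l \<le> j + 1" by auto
    have "tr k l \<le> j + 1" "\<not> sw k l" using k z assms by (auto simp: tr_def sw_def transpose_def)
    note tk = this
    consider "k = 0" | "k = 1" | "k = 2" | "3 \<le> k" by linarith
    then show "s z \<in> ?Z" using k z tk by cases (auto simp: R_simps)
  qed (use assms in auto)
  then show ?thesis by auto
qed

lemma perm_restrict:
  assumes "\<pi> permutes {i..n}" "\<And>k. m < k \<Longrightarrow> k \<le> n \<Longrightarrow> \<pi> k = k"
  shows "\<pi> permutes {i..m :: nat}"
  by (rule permutes_superset[OF assms(1)]) (use assms(2) in auto)

lemma inv_diagonal: "\<pi> permutes P \<Longrightarrow> W (inv' \<pi>) (\<lambda>_. False) \<circ> W \<pi> a = W id a"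
  by (simp add: W_comp permutes_inv_o)

text \<open>Conjugating the exchange on e + 2 to e + 5 by \<open>R (e + 1)\<close> replaces e + 2 by
  e + 1 in its support; the product of the two exchanges acts on e + 1 and e + 2 alone. Plain index
  permutations carry this pair to any other.\<close>

lemma pair_swap_gp:
  assumes "3 \<le> i" "i < e" "e < j" "j < e + 3" "i \<le> a" "a \<le> j + 1" "i \<le> b" "b \<le> j + 1" "a \<noteq> b"
  shows "W id (\<lambda>l. l = a \<or> l = b) \<in> gp (R ` {i..j})"
proof -
  let ?G = "gp (R ` {i..j})"
  let ?E = "W id (\<lambda>l. e + 2 \<le> l \<and> l \<le> e + 5)"
  let ?P = "W id (\<lambda>l. l = e + 1 \<or> l = e + 2)"
  have E: "?E \<in> ?G" using assms by (intro E4_gp) auto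
  have R: "R (e + 1) \<in> ?G" using assms by (auto intro!: gp_gen)
  have "(R (e + 1) \<circ> ?E \<circ> R (e + 1)) \<circ> ?E \<in> ?G" by (intro gp_comp E R)
  moreover have "(R (e + 1) \<circ> ?E \<circ> R (e + 1)) \<circ> ?E = ?P"
    using e by (auto simp: R_plain W_comp W_eq_iff fun_eq_iff[where 'a = nat] transpose_def)
  ultimately have P: "?P \<in> ?G" by simp
  \<comment> \<open>\<open>x\<close> is where the transposition of e + 1 and \<open>a\<close> puts e
    + 2. The second factor of \<open>\<pi>\<close> moves \<open>x\<close> to \<open>b\<close> and
    leaves \<open>a\<close> in place, since both differ from it.\<close>
  define x where "x = transpose (e + 1) a (e + 2)"
  define \<pi> where "\<pi> = transpose x b \<circ> transpose (e + 1) a"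
  have x: "x \<noteq> a" "x \<in> {i..j + 1}" using assms by (auto simp: x_def transpose_def)
  have \<pi>: "\<pi> permutes {i..j + 1}" unfolding \<pi>_def using x assms
    by (intro permutes_compose permutes_swap_id) auto
  have \<pi>_apply: "\<pi> (e + 1) = a" "\<pi> (e + 2) = b"
    using x assms by (simp_all only: \<pi>_def o_apply x_def[symmetric] transpose_apply_first) (auto simp: transpose_def)
  have gen: "W (transpose k (Suc k)) (\<lambda>_. False) \<in> ?G" if "i \<le> k" "k < j + 1" for k
    by (rule transposition_gp[of i j]) (use that assms in auto)
  have D: "W \<pi> (\<lambda>_. False) \<in> ?G" "W (inv' \<pi>) (\<lambda>_. False) \<in> ?G"
    using diagonal_gp \<pi> permutes_inv[OF \<pi>] gen by blast+
  have "W \<pi> (\<lambda>_. False) \<circ> ?P \<circ> W (inv' \<pi>) (\<lambda>_. False) = W id (\<lambda>l. inv' \<pi> l = e + 1 \<or> inv' \<pi> l = e + 2)"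
    by (simp add: W_comp permutes_inv_o[OF \<pi>])
  also have "\<dots> = W id (\<lambda>l. l = a \<or> l = b)"
    using \<pi>_apply permutes_inverses[OF \<pi>] by (metis (no_types, opaque_lifting))
  finally have "W \<pi> (\<lambda>_. False) \<circ> ?P \<circ> W (inv' \<pi>) (\<lambda>_. False) = W id (\<lambda>l. l = a \<or> l = b)" .
  moreover have "W \<pi> (\<lambda>_. False) \<circ> ?P \<circ> W (inv' \<pi>) (\<lambda>_. False) \<in> ?G"
    by (intro gp_comp D P)
  ultimately show ?thesis by simp
qed

text \<open>The target contains all plain permutations of \<open>{i..j + 1}\<close>, so only signs
  remain after trimming. For \<open>j \<le> e\<close> there are none by \<open>side_kept\<close>;
  for larger \<open>j\<close> parity allows removing them in pairs.\<close>

lemma inter_low: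
  assumes i: "3 \<le> i" "i < e" "i \<le> Suc j" and j: "j < e + 3"
    and g: "g \<in> gp (R ` {..j})" "g \<in> gp (R ` {i..<e + 4})"
  shows "g \<in> gp (R ` {i..j})"
proof -
  let ?G = "gp (R ` {i..j})"
  obtain t where t: "t \<in> ?G" "\<And>s k. j + 2 \<le> k \<Longrightarrow> t (g (T s k)) = T s k"
    using tail_trim[of i j g] assms by auto
  define h where "h = t \<circ> g"
  have sub: "{i..j} \<subseteq> {..j}" "{i..j} \<subseteq> {i..<e + 4}" "{i..j} \<subseteq> {..<e + 4}" using j by auto
  have h: "h \<in> gp (R ` {..j})" "h \<in> gp (R ` {i..<e + 4})"
    unfolding h_def using t(1) g gp_mono[OF _ image_mono] sub by (blast intro: gp_comp)+
  obtain \<pi> a where ha: "h = W \<pi> a" and shape: "tail_shape i \<pi> a" using tail_form h(2) i by blast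
  have fixd: "\<pi> k = k" "\<not> a k" if "j + 2 \<le> k" for k
    using t(2)[OF that, of False] fun_cong[OF ha, of "T False k"] by (auto simp: h_def)
  have \<pi>: "\<pi> permutes {i..j + 1}"
    by (rule perm_restrict[of _ _ "e + 5"]) (use shape fixd in \<open>auto simp: tail_shape_def\<close>)
  have supp: "i \<le> k \<and> k \<le> j + 1" if "a k" for k
    using shape fixd(2)[of k] that by (cases "j + 2 \<le> k") (auto simp: tail_shape_def)
  have gen: "W (transpose k (Suc k)) (\<lambda>_. False) \<in> ?G" if "i \<le> k" "k < j + 1" for k
    by (rule transposition_gp[of i j]) (use that i j in auto)
  have D: "W (inv' \<pi>) (\<lambda>_. False) \<in> ?G"
    using diagonal_gp permutes_inv[OF \<pi>] gen by blast
  have ida: "W (inv' \<pi>) (\<lambda>_. False) \<circ> h = W id a" using inv_diagonal[OF \<pi>] ha by simp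
  have "W id a \<in> ?G"
  proof (cases "j \<le> e")
    case True
    have "\<not> a k" for k
    proof
      assume "a k"
      then have "3 \<le> k" "k \<le> j + 1" using supp i by fastforce+
      then obtain l where "h (T True k) = T True l" using side_kept[OF True h(1)] by blast
      then show False using ha \<open>a k\<close> by simp
    qed
    then have "a = (\<lambda>_. False)" by blast
    then show ?thesis by (simp only: W_id gp_id)
  next
    case False
    have hV: "h \<in> gp (R ` {..<e + 4})" using h(2) by (rule gp_mono) auto
    have "W (inv' \<pi>) (\<lambda>_. False) \<circ> h \<in> gp (R ` {..<e + 4})"
      by (rule gp_comp[OF gp_mono[OF D image_mono[OF sub(3)]] hV])
    then have "W id a \<in> gp (R ` {..<e + 4})" by (simp only: ida)
    then show ?thesis
    proof (rule even_signs[rotated -1])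
      show "W id (\<lambda>l. l = k \<or> l = Suc k) \<in> ?G" if "i \<le> k" "k < j + 1" for k
        by (rule pair_swap_gp) (use that i j False in auto)
    qed (use supp sub in auto)
  qed
  then have "W (inv' \<pi>) (\<lambda>_. False) \<circ> h \<in> ?G" by (simp only: ida)
  then have "h \<in> ?G" using gp_cancel_left D involutive_R by blast
  then show ?thesis unfolding h_def using gp_cancel_left t(1) involutive_R by blast
qed

text \<open>Once the index permutation is removed, the sign pattern is constant on all six indices.
  The constant exchange is available by \<open>E6_gp\<close> if \<open>e < j\<close>; otherwise it
  would move \<open>T True (j + 1)\<close> to the other side, against
  \<open>side_kept\<close>.\<close>

lemma inter_e:
  assumes ij: "e \<le> Suc j" and j: "j < e + 3"
    and g: "g \<in> gp (R ` {..j})" "g \<in> gp (R ` {e..<e + 4})"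
  shows "g \<in> gp (R ` {e..j})"
proof -
  let ?G = "gp (R ` {e..j})"
  have e3: "3 \<le> e" using e by simp
  obtain t where t: "t \<in> ?G" "\<And>s k. j + 2 \<le> k \<Longrightarrow> t (g (T s k)) = T s k"
    using tail_trim[of e j g] assms e by auto
  define h where "h = t \<circ> g"
  have sub: "{e..j} \<subseteq> {..j}" "{e..j} \<subseteq> {e..<e + 4}" using j by auto
  have h: "h \<in> gp (R ` {..j})" "h \<in> gp (R ` {e..<e + 4})"
    unfolding h_def using t(1) g gp_mono[OF _ image_mono] sub by (blast intro: gp_comp)+
  obtain \<pi> a where ha: "h = W \<pi> a" and shape: "tail_shape e \<pi> a" using tail_form h(2) e3 by blast
  have fixd: "\<pi> k = k" if "j + 2 \<le> k" for k
    using t(2)[OF that, of False] fun_cong[OF ha, of "T False k"] by (auto simp: h_def)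
  have \<pi>: "\<pi> permutes {e..j + 1}"
    by (rule perm_restrict[of _ _ "e + 5"]) (use shape fixd in \<open>auto simp: tail_shape_def\<close>)
  have gen: "\<exists>b. W (transpose k (Suc k)) b \<in> ?G" if "e \<le> k" "k < j + 1" for k
  proof (cases "k = e + 2")
    case True
    then have "{Suc e, Suc (Suc e)} \<subseteq> {e..j}" using that by auto
    then show ?thesis using D23_gp[of "{e..j}"] True by (auto simp: numeral_3_eq_3)
  next
    case False
    then have "R k = W (transpose k (Suc k)) (sw k)" using that e3 by (simp add: R_W tr_def)
    moreover have "R k \<in> ?G" using that by (auto intro: gp_gen)
    ultimately show ?thesis by auto
  qed
  obtain b where b: "W (inv' \<pi>) b \<in> ?G" using diagonal_lift[OF permutes_inv[OF \<pi>] gen] by blast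
  define f where "f = W (inv' \<pi>) b \<circ> h"
  have f: "f \<in> gp (R ` {..j})" "f \<in> gp (R ` {e..<e + 4})"
    unfolding f_def using b h gp_mono[OF _ image_mono] sub by (blast intro: gp_comp)+
  obtain \<sigma> c where fc: "f = W \<sigma> c" and shape': "tail_shape e \<sigma> c" using tail_form f(2) e3 by blast
  have "\<sigma> = id" using fc by (simp add: f_def ha W_comp permutes_inv_o[OF \<pi>] W_eq_iff)
  then obtain d where d: "\<forall>k\<in>{e..e + 5}. c k = d" using shape' by (auto simp: tail_shape_def)
  have "c k \<Longrightarrow> e \<le> k \<and> k \<le> e + 5" for k using shape' unfolding tail_shape_def by blast
  then have c: "c k \<longleftrightarrow> e \<le> k \<and> k \<le> e + 5 \<and> d" for k using bspec[OF d, of k] by (metis atLeastAtMost_iff)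
  have "f \<in> ?G"
  proof (cases d)
    case False
    then have "c = (\<lambda>_. False)" using c by blast
    then show ?thesis using fc \<open>\<sigma> = id\<close> by (simp only: W_id gp_id)
  next
    case True
    have "e < j"
    proof (rule ccontr)
      assume "\<not> e < j"
      then obtain l where "f (T True (j + 1)) = T True l"
        using side_kept[OF _ f(1), of "j + 1"] ij e3 by auto
      moreover have "c (j + 1)" using c True ij j \<open>\<not> e < j\<close> by simp
      ultimately show False using fc by simp
    qed
    have "c = (\<lambda>l. e \<le> l \<and> l \<le> e + 5)" using c True by blast
    then show ?thesis using fc \<open>\<sigma> = id\<close> E6_gp[of "{e..j}"] \<open>e < j\<close> by simp
  qed
  then have "h \<in> ?G" unfolding f_def using gp_cancel_left b involutive_R by blast
  then show ?thesis unfolding h_def using gp_cancel_left t(1) involutive_R by blast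
qed

lemma index_kept:
  assumes "g \<in> gp (R ` {..j})" "j \<le> e + 1" "2 \<le> j" "j + 2 \<le> k"
  shows "\<exists>s'. g (T s k) = T s' k"
proof -
  let ?Z = "{T u k | u. True}"
  have "g (T s k) \<in> ?Z"
  proof (rule gp_stable[OF assms(1)])
    fix s z assume "s \<in> R ` {..j}" and "z \<in> ?Z"
    then obtain m u where m: "s = R m" "m \<le> j" and z: "z = T u k" by auto
    have "tr m k = k" using m assms by (auto simp: tr_def transpose_def)
    note tm = this
    consider "m = 0" | "m = 1" | "m = 2" | "3 \<le> m" by linarith
    then show "s z \<in> ?Z" using m z tm assms by cases (auto simp: R_simps)
  qed auto
  then show ?thesis by auto
qed

text \<open>The only link between these two indices and lower ones is \<open>R (e + 3)\<close>,
  which is missing here.\<close>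

lemma last_pair_kept:
  assumes "g \<in> gp (R ` {..e + 2})" "k = e + 4 \<or> k = e + 5"
  shows "\<exists>s' l. g (T s k) = T s' l \<and> (l = e + 4 \<or> l = e + 5)"
proof -
  let ?Z = "{T u l | u l. l = e + 4 \<or> l = e + 5}"
  have "g (T s k) \<in> ?Z"
  proof (rule gp_stable[OF assms(1)])
    fix s z assume "s \<in> R ` {..e + 2}" and "z \<in> ?Z"
    then obtain m u l where m: "s = R m" "m \<le> e + 2" and z: "z = T u l" "l = e + 4 \<or> l = e + 5" by auto
    have "tr m l = e + 4 \<or> tr m l = e + 5" using m z by (auto simp: tr_def transpose_def)
    note tm = this
    consider "m = 0" | "m = 1" | "m = 2" | "3 \<le> m" by linarith
    then show "s z \<in> ?Z" using m z e tm by cases (auto simp: R_simps)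
  qed (use assms in auto)
  then show ?thesis by auto
qed

text \<open>On the last four indices \<open>tr (e + 2)\<close> and \<open>tr (e + 3)\<close>
  generate a dihedral group of order 8. The reversal is the square of their product and therefore
  central.\<close>

lemma block_commute:
  assumes "g \<in> gp (R ` {e + 2..<e + 4})"
  shows "g \<circ> W (transpose (e + 2) (e + 5) \<circ> transpose (e + 3) (e + 4)) (\<lambda>_. False)
    = W (transpose (e + 2) (e + 5) \<circ> transpose (e + 3) (e + 4)) (\<lambda>_. False) \<circ> g"
proof (rule gp_commute[OF assms])
  let ?\<beta> = "transpose (e + 2) (e + 5) \<circ> transpose (e + 3) (e + 4)"
  fix s assume "s \<in> R ` {e + 2..<e + 4}"
  then obtain k where k: "s = R k" "k = e + 2 \<or> k = e + 3" by fastforce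
  have "tr k (?\<beta> l) = ?\<beta> (tr k l)" for l
  proof -
    consider "l = e + 2" | "l = e + 3" | "l = e + 4" | "l = e + 5" | "l \<notin> {e + 2, e + 3, e + 4, e + 5}" by blast
    then show ?thesis using k(2) by cases (elim disjE; simp add: tr_def transpose_def)+
  qed
  then have "tr k \<circ> ?\<beta> = ?\<beta> \<circ> tr k" by (auto simp: fun_eq_iff)
  moreover have "s = W (tr k) (\<lambda>_. False)" using k e by (auto simp: R_W sw_False)
  ultimately show "s \<circ> W ?\<beta> (\<lambda>_. False) = W ?\<beta> (\<lambda>_. False) \<circ> s" by (simp only: W_D_comp)
qed

text \<open>Commuting with the reversal couples e + 4 with e + 3 and e + 5 with e + 2, and
  \<open>last_pair_kept\<close> couples e + 5 with e + 4. So one fixed index forces the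
  identity.\<close>

lemma inter_last:
  assumes g: "g \<in> gp (R ` {..e + 2})" "g \<in> gp (R ` {e + 2..<e + 4})"
    and fix4: "g (T False (e + 4)) = T False (e + 4)"
  shows "g = id"
proof -
  let ?\<beta> = "transpose (e + 2) (e + 5) \<circ> transpose (e + 3) (e + 4)"
  obtain \<pi> a where ga: "g = W \<pi> a" and shape: "tail_shape (e + 2) \<pi> a"
    using tail_form[of "e + 2" g] g(2) e by auto
  have \<pi>: "\<pi> permutes {e + 2..e + 5}" and a: "a = (\<lambda>_. False)"
    using shape by (auto simp: tail_shape_def)
  have inj: "\<pi> k = \<pi> l \<longleftrightarrow> k = l" for k l using permutes_inj[OF \<pi>] by (simp add: inj_eq)
  have "g \<circ> W ?\<beta> (\<lambda>_. False) = W ?\<beta> (\<lambda>_. False) \<circ> g" by (rule block_commute[OF g(2)])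
  then have "\<pi> \<circ> ?\<beta> = ?\<beta> \<circ> \<pi>" by (simp only: ga a W_D_comp W_eq_iff)
  then have comm: "\<pi> (?\<beta> l) = ?\<beta> (\<pi> l)" for l by (metis comp_apply)
  have 4: "\<pi> (e + 4) = e + 4" using fix4 ga by simp
  moreover have "\<pi> (e + 5) = e + 4 \<or> \<pi> (e + 5) = e + 5"
    using last_pair_kept[OF g(1), of "e + 5" False] ga by auto
  ultimately have 5: "\<pi> (e + 5) = e + 5" using inj[of "e + 4" "e + 5"] by auto
  have 3: "\<pi> (e + 3) = e + 3" using comm[of "e + 4"] 4 by (simp add: transpose_def)
  have 2: "\<pi> (e + 2) = e + 2" using comm[of "e + 5"] 5 by (simp add: transpose_def)
  have "\<pi> l = l" for l
  proof (cases "l \<in> {e + 2..e + 5}")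
    case True
    then have "l = e + 2 \<or> l = e + 3 \<or> l = e + 4 \<or> l = e + 5" by auto
    then show ?thesis using 2 3 4 5 by auto
  qed (use \<pi> in \<open>simp add: permutes_not_in\<close>)
  then have "\<pi> = id" by auto
  then show ?thesis using ga a by (simp only: W_id)
qed

text \<open>No signs occur for \<open>e < i\<close>. If \<open>j = e + 2\<close>, the pair e + 4, e
  + 5 is kept, and the target is the product of the symmetric groups on e + 1 to e + 3 and on the
  pair for i = e + 1, generated by \<open>R (e + 2)\<close> for i = e + 2, and trivial for i = e +
  3.\<close>

lemma inter_high:
  assumes i: "e < i" "i \<le> Suc j" and j: "j < e + 3"
    and g: "g \<in> gp (R ` {..j})" "g \<in> gp (R ` {i..<e + 4})"
  shows "g \<in> gp (R ` {i..j})"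
proof -
  let ?G = "gp (R ` {i..j})"
  have i3: "3 \<le> i" using i e by simp
  obtain \<pi> a where ga: "g = W \<pi> a" and shape: "tail_shape i \<pi> a" using tail_form g(2) i3 by blast
  have \<pi>: "\<pi> permutes {i..e + 5}" and a: "a = (\<lambda>_. False)"
    using shape i by (auto simp: tail_shape_def)
  consider "j \<le> e + 1" | "j = e + 2" "i = e + 1" | "j = e + 2" "i = e + 2" | "j = e + 2" "i = e + 3"
    using i j by linarith
  then show ?thesis
  proof cases
    case 1
    have "\<pi> k = k" if "j + 2 \<le> k" for k
      using index_kept[OF g(1) 1 _ that, of False] i e ga by auto
    then have "\<pi> permutes {i..j + 1}" by (intro perm_restrict[OF \<pi>]) auto
    moreover have "W (transpose k (Suc k)) (\<lambda>_. False) \<in> ?G" if "i \<le> k" "k < j + 1" for k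
    proof -
      have "R k \<in> ?G" using that by (auto intro: gp_gen)
      moreover have "R k = W (transpose k (Suc k)) (\<lambda>_. False)" using that i e 1 by (intro R_plain) auto
      ultimately show ?thesis by simp
    qed
    ultimately show ?thesis unfolding ga a by (rule diagonal_gp)
  next
    case 2
    have gen: "W (transpose k (Suc k)) (\<lambda>_. False) \<in> ?G" if "i \<le> k" "k < e + 3" for k
    proof -
      have "k = e + 1 \<or> k = e + 2" using that 2 by auto
      then consider "k = e + 1" | "k = e + 2" by blast
      then show ?thesis
      proof cases
        case 1
        have "R k \<in> ?G" using 1 2 by (auto intro: gp_gen)
        moreover have "R k = W (transpose k (Suc k)) (\<lambda>_. False)" using 1 e by (intro R_plain) auto
        ultimately show ?thesis by simp
      next
        case k: 2
        show ?thesis using D23_gp[of "{i..j}"] 2 k by (simp add: numeral_3_eq_3)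
      qed
    qed
    have D: "W (transpose (e + 4) (e + 5)) (\<lambda>_. False) \<in> ?G" using 2 by (intro D45_gp) auto
    have pair: "\<pi> k = e + 4 \<or> \<pi> k = e + 5" if "k = e + 4 \<or> k = e + 5" for k
      using last_pair_kept[of g k False] g(1) 2 that ga by auto
    have inj: "\<pi> (e + 4) \<noteq> \<pi> (e + 5)" using permutes_inj[OF \<pi>] by (simp add: inj_eq)
    define \<sigma> where "\<sigma> = (if \<pi> (e + 4) = e + 4 then \<pi> else transpose (e + 4) (e + 5) \<circ> \<pi>)"
    have "transpose (e + 4) (e + 5) \<circ> \<pi> permutes {i..e + 5}"
      by (rule permutes_compose[OF \<pi> permutes_swap_id]) (use 2 in auto)
    then have "\<sigma> permutes {i..e + 5}" using \<pi> by (simp only: \<sigma>_def split: if_split) blast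
    moreover have "\<sigma> k = k" if "e + 3 < k" "k \<le> e + 5" for k
    proof -
      have "k = e + 4 \<or> k = e + 5" using that by linarith
      then show ?thesis using pair[of "e + 4"] pair[of "e + 5"] inj by (auto simp: \<sigma>_def)
    qed
    ultimately have "\<sigma> permutes {i..e + 3}" by (rule perm_restrict)
    then have S: "W \<sigma> (\<lambda>_. False) \<in> ?G" by (rule diagonal_gp) (rule gen)
    show ?thesis
    proof (cases "\<pi> (e + 4) = e + 4")
      case True
      then show ?thesis using S ga a by (simp add: \<sigma>_def)
    next
      case False
      then have "W (transpose (e + 4) (e + 5)) (\<lambda>_. False) \<circ> g \<in> ?G"
        using S ga a by (simp add: \<sigma>_def W_D_comp)
      then show ?thesis using gp_cancel_left D involutive_R by blast
    qed
  next
    case 3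
    have R: "R (e + 2) \<in> ?G" using 3 by (auto intro: gp_gen)
    have "\<pi> (e + 4) = e + 4 \<or> \<pi> (e + 4) = e + 5"
      using last_pair_kept[of g "e + 4" False] g(1) 3 ga by auto
    then show ?thesis
    proof
      assume "\<pi> (e + 4) = e + 4"
      then have "g = id" using inter_last[of g] g 3 ga a by simp
      then show ?thesis by (simp only: gp_id)
    next
      assume 5: "\<pi> (e + 4) = e + 5"
      have "R (e + 2) \<circ> g = id"
      proof (rule inter_last)
        show "R (e + 2) \<circ> g \<in> gp (R ` {..e + 2})" "R (e + 2) \<circ> g \<in> gp (R ` {e + 2..<e + 4})"
          using g 3 by (auto intro!: gp_step simp del: comp_apply)
        show "(R (e + 2) \<circ> g) (T False (e + 4)) = T False (e + 4)"
          using 5 ga a e by (simp add: R_W tr_def sw_def)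
      qed
      then have "R (e + 2) \<circ> g \<in> ?G" by (simp only: gp_id)
      then show ?thesis using gp_cancel_left R involutive_R by blast
    qed
  next
    case 4
    have "{i..<e + 4} = {e + 3}" using 4 by auto
    then have "g \<in> gp {R (e + 3)}" using g(2) by simp
    then have "g = id \<or> g = R (e + 3)" by (rule gp_singleton) (simp add: fun_eq_iff R_R)
    moreover have "R (e + 3) (T False (e + 4)) = T False (e + 3)"
      using e by (simp add: R_W tr_def sw_def transpose_def)
    moreover have "g (T False (e + 4)) \<noteq> T False (e + 3)"
      using last_pair_kept[of g "e + 4" False] g(1) 4 by auto
    ultimately have "g = id" by auto
    then show ?thesis by (simp only: gp_id)
  qed
qed

theorem R_intersection:
  assumes "J \<subseteq> {..<e + 4}" "K \<subseteq> {..<e + 4}"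
  shows "gp (R ` J) \<inter> gp (R ` K) = gp (R ` (J \<inter> K))"
proof
  show "gp (R ` (J \<inter> K)) \<subseteq> gp (R ` J) \<inter> gp (R ` K)" by (auto elim!: gp_mono)
  show "gp (R ` J) \<inter> gp (R ` K) \<subseteq> gp (R ` (J \<inter> K))"
  proof
    fix g assume g: "g \<in> gp (R ` J) \<inter> gp (R ` K)"
    show "g \<in> gp (R ` (J \<inter> K))"
    proof (rule intersection_criterion[OF _ assms])
      fix j i g
      assume j: "Suc j < e + 4" and i: "i \<le> Suc j"
        and g: "g \<in> gp (R ` {..j})" "g \<in> gp (R ` {i..<e + 4})"
      consider "i = 0" | "i = 1" "j = 0" | "i = 1 \<or> i = 2" "j = 1" | "i = 1 \<or> i = 2" "2 \<le> j"
        | "3 \<le> i" "i < e" | "i = e" | "e < i" using i by linarith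
      then show "g \<in> gp (R ` {i..j})"
      proof cases
        case 1
        then show ?thesis using g by (simp add: atLeast0AtMost)
      next
        case 2
        then have "g = id" using inter_0[of g] g by simp
        then show ?thesis by (simp only: gp_id)
      next
        case 3
        then show ?thesis using inter_1[of g i] g by auto
      next
        case 4
        then show ?thesis using inter_front[of g j i] g j by auto
      next
        case 5
        then show ?thesis using inter_low[of i j g] g i j by auto
      next
        case 6
        then show ?thesis using inter_e[of j g] g i j by auto
      next
        case 7
        then show ?thesis using inter_high[of i j g] g i j by auto
      qed
    qed (use g in auto)
  qed
qed

end

section \<open>The Schlaefli type\<close>

text \<open>Lower bounds for orders: a point on a cycle of length \<open>p\<close> makes
  \<open>p\<close> divide every exponent that yields the identity. Below, each order is the least
  common multiple of a few exhibited cycle lengths.\<close>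

lemma period_dvd:
  assumes "(f ^^ p) x = x" "0 < p" "\<And>i. 0 < i \<Longrightarrow> i < p \<Longrightarrow> (f ^^ i) x \<noteq> x" "f ^^ n = id"
  shows "p dvd n"
proof -
  have "(f ^^ (n mod p)) x = x" using funpow_mod_eq[OF assms(1), of n] assms(4) by simp
  moreover have "n mod p < p" using assms(2) by simp
  ultimately have "n mod p = 0" using assms(3) by blast
  then show ?thesis by (simp add: dvd_eq_mod_eq_0)
qed

lemma period_2: "f a = b \<Longrightarrow> f b = a \<Longrightarrow> a \<noteq> b \<Longrightarrow> f ^^ n = id \<Longrightarrow> 2 dvd n"
  by (rule period_dvd[of 2 f a]) (auto simp: numeral_eq_Suc less_Suc_eq)

lemma period_3: "f a = b \<Longrightarrow> f b = c \<Longrightarrow> f c = a \<Longrightarrow> a \<noteq> b \<Longrightarrow> a \<noteq> c \<Longrightarrow> f ^^ n = id \<Longrightarrow> 3 dvd n"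
  by (rule period_dvd[of 3 f a]) (auto simp: numeral_eq_Suc less_Suc_eq)

lemma period_4:
  "f a = b \<Longrightarrow> f b = c \<Longrightarrow> f c = d \<Longrightarrow> f d = a \<Longrightarrow> a \<noteq> b \<Longrightarrow> a \<noteq> c \<Longrightarrow> a \<noteq> d \<Longrightarrow> f ^^ n = id \<Longrightarrow> 4 dvd n"
  by (rule period_dvd[of 4 f a]) (auto simp: numeral_eq_Suc less_Suc_eq)

lemma power_eq_id_iff:
  assumes "f ^^ m = id" "\<And>n. f ^^ n = id \<Longrightarrow> m dvd n"
  shows "f ^^ n = id \<longleftrightarrow> m dvd n"
proof
  assume "m dvd n"
  then obtain q where "n = m * q" by auto
  moreover have "(f ^^ m) ^^ q = f ^^ (m * q)" by (rule funpow_mult)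
  moreover have "id ^^ q = (id :: 'a \<Rightarrow> 'a)" by (induction q) auto
  ultimately show "f ^^ n = id" using assms(1) by simp
qed (rule assms(2))

lemma funpow_times: "(f :: 'a \<Rightarrow> 'a) ^^ (a * b) = (f ^^ a) ^^ b"
  by (simp add: funpow_mult)

lemma dvd_6I: "2 dvd n \<Longrightarrow> 3 dvd n \<Longrightarrow> 6 dvd (n :: nat)"
  by presburger

lemma dvd_12I: "4 dvd n \<Longrightarrow> 3 dvd n \<Longrightarrow> 12 dvd (n :: nat)"
  by presburger

lemma W_sq_id: "W id a ^^ 2 = id"
proof -
  have "W id a \<circ> W id a = id" by (rule ext, rename_tac p, case_tac p) auto
  then show ?thesis by (simp add: numeral_2_eq_2)
qed

context pt_graph
begin

lemma order_0: "(R 0 \<circ> R 1) ^^ n = id \<longleftrightarrow> M dvd n"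
proof (rule power_eq_id_iff)
  have pow: "(rot ^^ M) (F 1) = F 1" using rot_pow_F[of M] M(1) by simp
  show "(R 0 \<circ> R 1) ^^ M = id" unfolding rot_def[symmetric]
  proof (rule dihedral_fix)
    show "rot ^^ M \<in> gp (R ` {0, 1})" unfolding rot_def by (intro gp_pow gp_comp gp_gen) auto
    show "rot \<circ> rot ^^ M = rot ^^ M \<circ> rot" by (simp add: fun_eq_iff funpow_swap1)
  qed (rule pow)
  show "M dvd n" if "(R 0 \<circ> R 1) ^^ n = id" for n
  proof (rule period_dvd)
    show "(rot ^^ M) (F 1) = F 1" by (rule pow)
    show "(rot ^^ i) (F 1) \<noteq> F 1" if "0 < i" "i < M" for i
      using rot_pow_F[of i] that by (auto split: if_splits)
    show "rot ^^ n = id" using that by (simp add: rot_def)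
  qed (use M in simp)
qed

lemma order_1: "(R 1 \<circ> R 2) ^^ n = id \<longleftrightarrow> 12 dvd n"
proof (rule power_eq_id_iff)
  have "F M \<noteq> T False 3" "T False 3 \<noteq> F (M - 1)" "F M \<noteq> F (M - 1)" using M(1) by auto
  note cube = cyc3_cube[OF this]
  have "(R 1 \<circ> R 2) ^^ 12 = ((R 1 \<circ> R 2) ^^ 4) ^^ 3" using funpow_times[of 4 3 "R 1 \<circ> R 2"] by simp
  also have "\<dots> = id" unfolding R1_R2_4 using cube by (simp add: numeral_3_eq_3)
  finally show "(R 1 \<circ> R 2) ^^ 12 = id" .
  show "12 dvd n" if "(R 1 \<circ> R 2) ^^ n = id" for n
  proof (rule dvd_12I)
    show "4 dvd n" by (rule period_4[of "R 1 \<circ> R 2", OF R1_R2_apply(1,2,4,3)]) (use that in simp_all)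
    show "3 dvd n" by (rule period_3[of "R 1 \<circ> R 2", OF R1_R2_apply(6,7,5)]) (use that M(1) in auto)
  qed
qed

lemma order_2: "(R 2 \<circ> R 3) ^^ n = id \<longleftrightarrow> 6 dvd n"
proof (rule power_eq_id_iff)
  have "F M \<noteq> T False 4" "T False 4 \<noteq> T False 3" "F M \<noteq> T False 3" by auto
  note cube = cyc3_cube[OF this]
  have sq: "(R 2 \<circ> R 3) ^^ 2 = cyc3 (F M) (T False 4) (T False 3)"
    using R2_R3_sq by (simp add: numeral_2_eq_2)
  have "(R 2 \<circ> R 3) ^^ 6 = ((R 2 \<circ> R 3) ^^ 2) ^^ 3" using funpow_times[of 2 3 "R 2 \<circ> R 3"] by simp
  also have "\<dots> = id" unfolding sq using cube by (simp add: numeral_3_eq_3)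
  finally show "(R 2 \<circ> R 3) ^^ 6 = id" .
  have tr3: "tr 3 3 = 4" "tr 3 4 = 3" "\<not> sw 3 l" for l using e by (auto simp: tr_def sw_def)
  show "6 dvd n" if "(R 2 \<circ> R 3) ^^ n = id" for n
  proof (rule dvd_6I)
    show "2 dvd n" by (rule period_2[of _ "F 3" "F 4"]) (use that M(1) in \<open>auto simp: R_simps\<close>)
    show "3 dvd n"
      by (rule period_3[of _ "F M" "T False 3" "T False 4"]) (use that M(1) in \<open>auto simp: R_simps tr3\<close>)
  qed
qed

lemma order_plain:
  assumes k: "3 \<le> k" "k + 2 \<le> e"
  shows "(R k \<circ> R (Suc k)) ^^ n = id \<longleftrightarrow> 3 dvd n"
proof (rule power_eq_id_iff)
  have R: "R k = W (transpose k (Suc k)) (\<lambda>_. False)" "R (Suc k) = W (transpose (Suc k) (Suc (Suc k))) (\<lambda>_. False)"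
    using k by (auto intro!: R_plain)
  let ?c = "cyc3 k (Suc k) (Suc (Suc k))"
  have RR: "R k \<circ> R (Suc k) = W ?c (\<lambda>_. False)" unfolding R by (rule W_D_comp)
  show "(R k \<circ> R (Suc k)) ^^ 3 = id"
    unfolding RR using cyc3_cube[of k "Suc k" "Suc (Suc k)"]
    by (simp add: numeral_3_eq_3 W_D_comp W_id del: comp_apply)
  show "3 dvd n" if "(R k \<circ> R (Suc k)) ^^ n = id" for n
    by (rule period_3[of _ "T False k" "T False (Suc k)" "T False (Suc (Suc k))"])
      (use that R in \<open>auto simp: transpose_def\<close>)
qed

lemma order_e_minus_1:
  assumes k: "Suc k = e"
  shows "(R k \<circ> R e) ^^ n = id \<longleftrightarrow> 6 dvd n"
proof (rule power_eq_id_iff)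
  have "(R k \<circ> R e) ^^ 6 = ((R k \<circ> R e) ^^ 3) ^^ 2" using funpow_times[of 3 2 "R k \<circ> R e"] by simp
  also have "\<dots> = id" unfolding cube_e_minus_1[OF k] by (rule W_sq_id)
  finally show "(R k \<circ> R e) ^^ 6 = id" .
  have R: "R k = W (transpose k e) (\<lambda>_. False)" "R e = W (transpose e (Suc e)) (sw e)"
    using R_plain[of k] R_W[of e] k e by (auto simp: tr_def)
  show "6 dvd n" if "(R k \<circ> R e) ^^ n = id" for n
  proof (rule dvd_6I)
    show "2 dvd n"
      by (rule period_2[of _ "T False (e + 2)" "T True (e + 2)"]) (use that k in \<open>auto simp: R sw_def transpose_def\<close>)
    show "3 dvd n"
      by (rule period_3[of _ "T False k" "T False e" "T False (Suc e)"])
        (use that k in \<open>auto simp: R sw_def transpose_def\<close>)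
  qed
qed

lemma order_e: "(R e \<circ> R (Suc e)) ^^ n = id \<longleftrightarrow> 6 dvd n"
proof (rule power_eq_id_iff)
  have "(R e \<circ> R (Suc e)) ^^ 6 = ((R e \<circ> R (Suc e)) ^^ 3) ^^ 2"
    using funpow_times[of 3 2 "R e \<circ> R (Suc e)"] by simp
  also have "\<dots> = id" unfolding cube_e by (rule W_sq_id)
  finally show "(R e \<circ> R (Suc e)) ^^ 6 = id" .
  have R: "R e = W (transpose e (Suc e)) (sw e)" "R (Suc e) = W (transpose (Suc e) (Suc (Suc e))) (\<lambda>_. False)"
    using R_plain[of "Suc e"] R_W[of e] e by (auto simp: tr_def)
  \<comment> \<open>The 3-cycle of indices changes the side once per turn, so its six vertices form
    a single 6-cycle.\<close>
  show "6 dvd n" if "(R e \<circ> R (Suc e)) ^^ n = id" for n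
  proof (rule period_dvd[of 6 _ "T False e"])
    let ?f = "R e \<circ> R (Suc e)"
    have f: "?f (T s e) = T s (Suc e)" "?f (T s (Suc e)) = T (\<not> s) (Suc (Suc e))" "?f (T s (Suc (Suc e))) = T s e" for s
      by (auto simp: R sw_def transpose_def)
    have 6: "(g ^^ 6) x = g (g (g (g (g (g x)))))" for g :: "pt \<Rightarrow> pt" and x by (simp add: numeral_eq_Suc)
    show "(?f ^^ 6) (T False e) = T False e" by (simp only: 6 f not_True_eq_False not_False_eq_True)
    fix i :: nat assume "0 < i" "i < 6"
    then have "i = 1 \<or> i = 2 \<or> i = 3 \<or> i = 4 \<or> i = 5" by linarith
    then show "(?f ^^ i) (T False e) \<noteq> T False e" using f by (elim disjE) (simp_all add: numeral_eq_Suc)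
  qed (use that in auto)
qed

lemma order_e_plus_1: "(R (e + 1) \<circ> R (e + 2)) ^^ n = id \<longleftrightarrow> 6 dvd n"
proof (rule power_eq_id_iff)
  have cube: "(R (e + 1) \<circ> R (e + 2)) ^^ 3 = W (transpose (e + 4) (e + 5)) (\<lambda>_. False)"
    using cube_e_plus_1 by simp
  have "(R (e + 1) \<circ> R (e + 2)) ^^ 6 = ((R (e + 1) \<circ> R (e + 2)) ^^ 3) ^^ 2"
    using funpow_times[of 3 2 "R (e + 1) \<circ> R (e + 2)"] by simp
  also have "\<dots> = id" unfolding cube by (simp add: numeral_2_eq_2 W_D_comp W_id)
  finally show "(R (e + 1) \<circ> R (e + 2)) ^^ 6 = id" .
  have R: "R (e + 1) = W (tr (e + 1)) (\<lambda>_. False)" "R (e + 2) = W (tr (e + 2)) (\<lambda>_. False)"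
    using R_W[of "e + 1"] R_W[of "e + 2"] e by (auto simp: sw_False)
  show "6 dvd n" if "(R (e + 1) \<circ> R (e + 2)) ^^ n = id" for n
  proof (rule dvd_6I)
    show "2 dvd n"
      by (rule period_2[of "R (e + 1) \<circ> R (e + 2)" "T False (e + 4)" "T False (e + 5)"])
        (use that in \<open>simp_all only: R\<close>, simp_all add: tr_def transpose_def)
    show "3 dvd n"
      by (rule period_3[of "R (e + 1) \<circ> R (e + 2)" "T False (e + 1)" "T False (e + 2)" "T False (e + 3)"])
        (use that in \<open>simp_all only: R\<close>, simp_all add: tr_def transpose_def)
  qed
qed

lemma order_e_plus_2: "(R (e + 2) \<circ> R (e + 3)) ^^ n = id \<longleftrightarrow> 4 dvd n"
proof (rule power_eq_id_iff)
  have R: "R (e + 2) = W (tr (e + 2)) (\<lambda>_. False)" "R (e + 3) = W (tr (e + 3)) (\<lambda>_. False)"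
    using R_W[of "e + 3"] R_W[of "e + 2"] e by (auto simp: sw_False)
  let ?f = "R (e + 2) \<circ> R (e + 3)"
  have f: "?f (T s (e + 2)) = T s (e + 3)" "?f (T s (e + 3)) = T s (e + 5)" "?f (T s (e + 5)) = T s (e + 4)"
    "?f (T s (e + 4)) = T s (e + 2)" "l \<notin> {e + 2, e + 3, e + 4, e + 5} \<Longrightarrow> ?f (T s l) = T s l"
    "?f (F x) = F x" for s l x
    by (simp_all only: R, auto simp: tr_def transpose_def)
  have 4: "(?f ^^ 4) p = ?f (?f (?f (?f p)))" for p by (simp add: numeral_eq_Suc)
  show "?f ^^ 4 = id"
  proof
    fix p
    show "(?f ^^ 4) p = id p"
    proof (cases p)
      case (T s l)
      consider "l = e + 2" | "l = e + 3" | "l = e + 4" | "l = e + 5" | "l \<notin> {e + 2, e + 3, e + 4, e + 5}" by blast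
      then show ?thesis unfolding 4 T by cases (simp_all only: f id_apply not_False_eq_True)
    qed (simp only: 4 f id_apply)
  qed
  show "4 dvd n" if "?f ^^ n = id" for n
    by (rule period_4[of ?f, OF f(1)[of False] f(2)[of False] f(3)[of False] f(4)[of False]]) (use that in simp_all)
qed

lemma R_nontrivial: "k < e + 4 \<Longrightarrow> R k \<noteq> id"
proof
  assume k: "k < e + 4" and id: "R k = id"
  consider "k = 0" | "k = 1" | "k = 2" | "3 \<le> k" by linarith
  then show False
  proof cases
    case 1
    then show ?thesis using fun_cong[OF id, of "F 1"] M(1) by (simp add: R_simps)
  next
    case 2
    then show ?thesis using fun_cong[OF id, of "F 2"] M(1) by (simp add: R_simps)
  next
    case 3
    then show ?thesis using fun_cong[OF id, of "F 3"] by (simp add: R_simps)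
  next
    case 4
    then show ?thesis using fun_cong[OF id, of "T False k"] by (simp add: R_simps tr_up)
  qed
qed

end

section \<open>Transport to permutations of {1..n}\<close>

text \<open>The uniqueness that \<open>THE\<close> needs follows once the edges with label
  \<open>k\<close> are the graph of a function.\<close>

lemma lgraph_perm_eqI:
  assumes "\<And>x y. x \<noteq> y \<Longrightarrow> ({x, y}, k) \<in> E \<longleftrightarrow> f x = y"
  shows "lgraph_perm E k = f"
proof
  fix x
  show "lgraph_perm E k x = f x"
  proof (cases "f x = x")
    case True
    then show ?thesis using assms[of x] by (auto simp: lgraph_perm_def)
  next
    case False
    then have "(y \<noteq> x \<and> ({x, y}, k) \<in> E) \<longleftrightarrow> y = f x" for y using assms[of x y] by auto
    then show ?thesis unfolding lgraph_perm_def by simp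
  qed
qed

context pt_graph
begin

text \<open>With L = M - 4 and r = e + 4 these are the prescribed codes: L + 2 + j for y_j and L + r
  + 1 + j for z_j.\<close>

primrec enc :: "pt \<Rightarrow> nat" where
  "enc (F x) = x"
| "enc (T s j) = (if s then M + e + 1 + j else M - 2 + j)"

lemma enc_bij: "bij_betw enc V {1..M + 2 * e + 6}"
proof (rule bij_betwI')
  show "enc v = enc w \<longleftrightarrow> v = w" if "v \<in> V" "w \<in> V" for v w
    using that M(1) by (cases v; cases w) (auto split: if_splits)
  show "enc v \<in> {1..M + 2 * e + 6}" if "v \<in> V" for v
    using that M(1) by (cases v) auto
  fix y assume y: "y \<in> {1..M + 2 * e + 6}"
  consider "y \<le> M" | "M < y" "y \<le> M + e + 3" | "M + e + 3 < y" by linarith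
  then show "\<exists>v\<in>V. y = enc v"
  proof cases
    case 1
    then show ?thesis using y by (intro bexI[of _ "F y"]) auto
  next
    case 2
    then show ?thesis using y M(1) by (intro bexI[of _ "T False (y - (M - 2))"]) auto
  next
    case 3
    then show ?thesis using y M(1) by (intro bexI[of _ "T True (y - (M + e + 1))"]) auto
  qed
qed

lemma enc_inj: "inj_on enc V"
  using enc_bij by (rule bij_betw_imp_inj_on)

definition \<phi> :: "(pt \<Rightarrow> pt) \<Rightarrow> nat \<Rightarrow> nat" where "\<phi> = map_permutation V enc"

lemma \<phi>_apply: "v \<in> V \<Longrightarrow> \<phi> p (enc v) = enc (p v)"
  unfolding \<phi>_def by (rule map_permutation_apply[OF enc_inj])

lemma \<phi>_permutes: "p permutes V \<Longrightarrow> \<phi> p permutes {1..M + 2 * e + 6}"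
  unfolding \<phi>_def by (rule map_permutation_permutes[OF enc_bij])

lemma \<phi>_comp: "q permutes V \<Longrightarrow> \<phi> (p \<circ> q) = \<phi> p \<circ> \<phi> q"
  unfolding \<phi>_def by (rule map_permutation_compose'[OF enc_inj])

lemma \<phi>_id: "\<phi> id = id"
  unfolding \<phi>_def by (rule map_permutation_id'[OF enc_inj])

lemma \<phi>_even: "p permutes V \<Longrightarrow> evenperm (\<phi> p) = evenperm p"
  unfolding \<phi>_def by (rule evenperm_map_permutation[OF enc_inj _ finite_V])

lemma \<phi>_eq_iff:
  assumes "p permutes V" "q permutes V"
  shows "\<phi> p = \<phi> q \<longleftrightarrow> p = q"
proof
  assume *: "\<phi> p = \<phi> q"
  show "p = q"
  proof
    fix v
    show "p v = q v"
    proof (cases "v \<in> V")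
      case True
      then have "enc (p v) = enc (q v)" using * \<phi>_apply by metis
      then show ?thesis using inj_onD[OF enc_inj] True assms permutes_in_image by metis
    qed (use assms in \<open>simp add: permutes_not_in\<close>)
  qed
qed simp

lemma \<phi>_funpow:
  assumes "p permutes V"
  shows "\<phi> (p ^^ n) = \<phi> p ^^ n"
proof (induction n)
  case (Suc n)
  have "p ^^ n permutes V" using assms by (rule permutes_funpow)
  then have "\<phi> (p \<circ> p ^^ n) = \<phi> p \<circ> \<phi> (p ^^ n)" by (rule \<phi>_comp)
  then show ?case using Suc by (simp only: funpow.simps)
qed (simp only: funpow.simps \<phi>_id)

lemma \<phi>_surj:
  assumes "p permutes {1..M + 2 * e + 6}"
  obtains q where "q permutes V" "\<phi> q = p"
proof (rule that)
  let ?d = "inv_into V enc"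
  have d: "bij_betw ?d {1..M + 2 * e + 6} V" using enc_bij by (rule bij_betw_inv_into)
  show "map_permutation {1..M + 2 * e + 6} ?d p permutes V"
    by (rule map_permutation_permutes[OF d assms])
  show "\<phi> (map_permutation {1..M + 2 * e + 6} ?d p) = p"
    unfolding \<phi>_def
  proof (rule map_permutation_compose_inv[OF d assms])
    show "enc (?d x) = x" if "x \<in> {1..M + 2 * e + 6}" for x
      using that enc_bij by (simp add: bij_betw_inv_into_right)
  qed
qed

definition N :: nat where "N = M + 2 * e + 6"
definition rk :: nat where "rk = e + 4"

section \<open>The prescribed edges and the action of the generators\<close>

lemma L_eq: "thm410_L N rk = M - 4"
  by (simp add: thm410_L_def N_def rk_def)

lemma edges_eq: "thm410_edges N rk =
     {({1, 2}, 0), ({2, 3}, 1), ({3, 4}, 0), ({3, 4}, 2)}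
   \<union> {({3 + s, 4 + s}, if odd s then 1 else 0) | s. 1 \<le> s \<and> s \<le> M - 4}
   \<union> {({M - 2 + k, M - 2 + (k + 1)}, k) | k. 2 \<le> k \<and> k \<le> e + 3}
   \<union> {({M - 2 + (e + 4), M - 2 + (e + 5)}, e + 2)}
   \<union> {({M + e + 1 + k, M + e + 1 + (k + 1)}, k) | k. 3 \<le> k \<and> k \<le> e + 3}
   \<union> {({M + e + 1 + (e + 4), M + e + 1 + (e + 5)}, e + 2)}
   \<union> {({M - 2 + j, M + e + 1 + j}, e) | j. j \<in> {e + 2, e + 3, e + 4, e + 5}}"
proof -
  have L: "M - 4 + 2 = M - 2" using M(1) by simp
  have M4: "M - 4 + (e + 4) + 1 = M + e + 1" using M(1) by simp
  have q: "{({thm410_q N rk (s - 1), thm410_q N rk s}, if odd s then 1 else 0 :: nat) | s. 1 \<le> s \<and> s \<le> M - 4}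
    = {({3 + s, 4 + s}, if odd s then 1 else 0) | s. 1 \<le> s \<and> s \<le> M - 4}"
  proof -
    have "1 \<le> s \<Longrightarrow> 4 + (s - 1) = 3 + s" for s :: nat by simp
    then show ?thesis unfolding thm410_q_def by (metis (no_types, lifting))
  qed
  show ?thesis
    unfolding thm410_edges_def thm410_y_def thm410_z_def L_eq q L
    unfolding rk_def M4 by (simp add: add.assoc numeral_eq_Suc)
qed

text \<open>With \<open>edge_complete\<close> this identifies the edges labelled \<open>k\<close>
  with the pairs of \<open>v\<close> and \<open>R k v\<close> for moved vertices \<open>v\<close>.
  One orientation per edge is enough, as \<open>R k\<close> is an involution.\<close>

lemma edge_sound:
  assumes "(S, k) \<in> thm410_edges N rk"
  shows "\<exists>v\<in>V. S = {enc v, enc (R k v)}"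
proof -
  have I: ?thesis if "v \<in> V" "S = {enc v, enc (R k v)}" for v using that by blast
  show ?thesis
    using assms unfolding edges_eq
  proof (elim UnE)
    assume "(S, k) \<in> {({1, 2}, 0), ({2, 3}, 1), ({3, 4}, 0), ({3, 4}, 2)}"
    then consider "S = {1, 2}" "k = 0" | "S = {2, 3}" "k = 1" | "S = {3, 4}" "k = 0" | "S = {3, 4}" "k = 2"
      by blast
    then show ?thesis
    proof cases
      case 1
      then show ?thesis using M(1) by (intro I[of "F 1"]) (auto simp: R_simps)
    next
      case 2
      then show ?thesis using M(1) by (intro I[of "F 2"]) (auto simp: R_simps)
    qed (use M(1) in \<open>intro I[of "F 3"]; auto simp: R_simps\<close>)+
  next
    assume "(S, k) \<in> {({3 + s, 4 + s}, if odd s then 1 else 0) | s. 1 \<le> s \<and> s \<le> M - 4}"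
    then obtain s where "S = {3 + s, 4 + s}" "k = (if odd s then 1 else 0)" "1 \<le> s" "s \<le> M - 4" by blast
    then show ?thesis using M(1) by (intro I[of "F (3 + s)"]) (auto simp: R_simps)
  next
    assume "(S, k) \<in> {({M - 2 + k, M - 2 + (k + 1)}, k) | k. 2 \<le> k \<and> k \<le> e + 3}"
    then have S: "S = {M - 2 + k, M - 2 + (k + 1)}" "2 \<le> k" "k \<le> e + 3" by blast+
    show ?thesis
    proof (cases "k = 2")
      case True
      then show ?thesis using S M(1) by (intro I[of "F M"]) (auto simp: R_simps)
    next
      case False
      then show ?thesis using S by (intro I[of "T False k"]) (auto simp: R_simps tr_up sw_def)
    qed
  next
    assume "(S, k) \<in> {({M - 2 + (e + 4), M - 2 + (e + 5)}, e + 2)}"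
    then have S: "S = {M - 2 + (e + 4), M - 2 + (e + 5)}" "k = e + 2" by blast+
    have "R k (T False (e + 4)) = T False (e + 5)" using S e by (simp add: R_W tr_def sw_def)
    then show ?thesis using S by (intro I[of "T False (e + 4)"]) auto
  next
    assume "(S, k) \<in> {({M + e + 1 + k, M + e + 1 + (k + 1)}, k) | k. 3 \<le> k \<and> k \<le> e + 3}"
    then have "S = {M + e + 1 + k, M + e + 1 + (k + 1)}" "3 \<le> k" "k \<le> e + 3" by blast+
    then show ?thesis by (intro I[of "T True k"]) (auto simp: R_simps tr_up sw_def)
  next
    assume "(S, k) \<in> {({M + e + 1 + (e + 4), M + e + 1 + (e + 5)}, e + 2)}"
    then have S: "S = {M + e + 1 + (e + 4), M + e + 1 + (e + 5)}" "k = e + 2" by blast+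
    have "R k (T True (e + 4)) = T True (e + 5)" using S e by (simp add: R_W tr_def sw_def)
    then show ?thesis using S by (intro I[of "T True (e + 4)"]) auto
  next
    assume "(S, k) \<in> {({M - 2 + j, M + e + 1 + j}, e) | j. j \<in> {e + 2, e + 3, e + 4, e + 5}}"
    then obtain j where S: "S = {M - 2 + j, M + e + 1 + j}" "k = e" "j \<in> {e + 2, e + 3, e + 4, e + 5}" by blast
    then have "R k (T False j) = T True j" using e by (auto simp: R_W tr_def sw_def transpose_def)
    then show ?thesis using S e by (intro I[of "T False j"]) auto
  qed
qed

lemma first_edges:
  "({1, 2}, 0) \<in> thm410_edges N rk" "({2, 3}, 1) \<in> thm410_edges N rk"
  "({3, 4}, 0) \<in> thm410_edges N rk" "({3, 4}, 2) \<in> thm410_edges N rk"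
  unfolding edges_eq by (simp_all only: Un_iff insert_iff simp_thms)

lemma path_edge:
  assumes x: "1 \<le> x" "x < M"
  shows "({x, Suc x}, if odd x then 0 else 1) \<in> thm410_edges N rk"
proof (cases "x \<le> 3")
  case True
  define y where "y = Suc x"
  then have "x = 1 \<and> y = 2 \<or> x = 2 \<and> y = 3 \<or> x = 3 \<and> y = 4" using x True by linarith
  then show ?thesis unfolding y_def[symmetric] using first_edges by auto
next
  case False
  define s where "s = x - 3"
  have s: "1 \<le> s" "s \<le> M - 4" "x = 3 + s" using False x by (auto simp: s_def)
  then have "({3 + s, 4 + s}, if odd s then 1 else 0) \<in> {({3 + s, 4 + s}, if odd s then 1 else 0 :: nat) | s. 1 \<le> s \<and> s \<le> M - 4}"
    by blast
  then have "({3 + s, 4 + s}, if odd s then 1 else 0) \<in> thm410_edges N rk"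
    unfolding edges_eq by (simp only: Un_iff simp_thms)
  moreover have "{x, Suc x} = {3 + s, 4 + s}" "(if odd x then 0 else 1 :: nat) = (if odd s then 1 else 0)"
    using s(3) by auto
  ultimately show ?thesis by (simp only:)
qed

lemma tail_edge_y:
  assumes "2 \<le> k" "k < e + 4"
  shows "({M - 2 + k, M - 2 + (k + 1)}, k) \<in> thm410_edges N rk"
proof -
  have "({M - 2 + k, M - 2 + (k + 1)}, k) \<in> {({M - 2 + k, M - 2 + (k + 1)}, k) | k. 2 \<le> k \<and> k \<le> e + 3}"
    using assms by force
  then show ?thesis unfolding edges_eq by (simp only: Un_iff simp_thms)
qed

lemma tail_edge_z:
  assumes "3 \<le> k" "k < e + 4"
  shows "({M + e + 1 + k, M + e + 1 + (k + 1)}, k) \<in> thm410_edges N rk"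
proof -
  have "({M + e + 1 + k, M + e + 1 + (k + 1)}, k) \<in> {({M + e + 1 + k, M + e + 1 + (k + 1)}, k) | k. 3 \<le> k \<and> k \<le> e + 3}"
    using assms by force
  then show ?thesis unfolding edges_eq by (simp only: Un_iff simp_thms)
qed

lemma tail_edge:
  assumes "3 \<le> k" "k < e + 4"
  shows "({enc (T s k), enc (T s (Suc k))}, k) \<in> thm410_edges N rk"
  using tail_edge_y[of k] tail_edge_z[of k] assms by (cases s) auto

lemma tail_last_edge: "({enc (T s (e + 4)), enc (T s (e + 5))}, e + 2) \<in> thm410_edges N rk"
proof -
  have "({M - 2 + (e + 4), M - 2 + (e + 5)}, e + 2) \<in> thm410_edges N rk"
    "({M + e + 1 + (e + 4), M + e + 1 + (e + 5)}, e + 2) \<in> thm410_edges N rk"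
    unfolding edges_eq by (simp_all only: Un_iff insert_iff simp_thms)
  then show ?thesis by (cases s) simp_all
qed

lemma side_edge:
  assumes "e + 2 \<le> j" "j \<le> e + 5"
  shows "({enc (T s j), enc (T (\<not> s) j)}, e) \<in> thm410_edges N rk"
proof -
  have "j \<in> {e + 2, e + 3, e + 4, e + 5}" using assms by auto
  then have "({M - 2 + j, M + e + 1 + j}, e) \<in> {({M - 2 + j, M + e + 1 + j}, e) | j. j \<in> {e + 2, e + 3, e + 4, e + 5}}"
    by blast
  then have "({M - 2 + j, M + e + 1 + j}, e) \<in> thm410_edges N rk"
    unfolding edges_eq by (simp only: Un_iff simp_thms)
  then show ?thesis by (cases s) (auto simp: insert_commute)
qed

lemma edge_complete:
  assumes k: "k < rk" and v: "v \<in> V" and ne: "R k v \<noteq> v"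
  shows "({enc v, enc (R k v)}, k) \<in> thm410_edges N rk"
proof -
  have k4: "k < e + 4" using k by (simp add: rk_def)
  consider "k = 0" | "k = 1" | "k = 2" | "3 \<le> k" by linarith
  then show ?thesis
  proof cases
    case 1
    then obtain x where x: "v = F x" using ne by (cases v) (auto simp: R_simps)
    then have lt: "1 \<le> x" "x < M" using ne 1 by (auto simp: R_simps split: if_splits)
    show ?thesis
    proof (cases "odd x")
      case True
      then show ?thesis using path_edge[of x] x lt 1 by (simp add: R_simps)
    next
      case False
      then have "1 \<le> x - 1" "Suc (x - 1) = x" "odd (x - 1)" using lt by (cases "x = 1"; auto)+
      then show ?thesis using path_edge[of "x - 1"] x lt 1 False by (simp add: R_simps insert_commute)
    qed
  next
    case 2
    then obtain x where x: "v = F x" using ne by (cases v) (auto simp: R_simps)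
    then have lt: "2 \<le> x" "x \<le> M" using ne 2 by (auto simp: R_simps split: if_splits)
    show ?thesis
    proof (cases "even x")
      case True
      then show ?thesis using path_edge[of x] even_less[of x] x lt 2 by (simp add: R_simps)
    next
      case False
      then have "1 \<le> x - 1" "Suc (x - 1) = x" "even (x - 1)" using lt by auto
      then show ?thesis using path_edge[of "x - 1"] x lt 2 False by (simp add: R_simps insert_commute)
    qed
  next
    case 3
    have y: "({M, M + 1}, 2) \<in> thm410_edges N rk" 
    proof -
      have "({M - 2 + 2, M - 2 + (2 + 1)}, 2) \<in> thm410_edges N rk" by (rule tail_edge_y) auto
      moreover have "M - 2 + 2 = M" "M - 2 + (2 + 1) = M + 1" using M(1) by auto
      ultimately show ?thesis by (simp only:)
    qed
    note p = first_edges(4)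
    consider "v = F 3" | "v = F 4" | "v = F M" | "v = T False 3"
      using ne 3 by (cases v) (auto simp: R_simps split: if_splits)
    then show ?thesis using y p 3 M(1) by cases (auto simp: R_simps insert_commute)
  next
    case 4
    then obtain s j where v: "v = T s j" using ne by (cases v) (auto simp: R_simps)
    consider "j = k" | "j = Suc k" | "k = e + 2" "j = e + 4" | "k = e + 2" "j = e + 5" | "k = e" "e + 2 \<le> j" "j \<le> e + 5"
      using ne v 4 by (auto simp: R_simps tr_def sw_def transpose_def split: if_splits)
    then show ?thesis
    proof cases
      case 1
      then show ?thesis using tail_edge[OF 4 k4, of s] v 4 by (simp add: R_simps tr_up sw_def)
    next
      case 2
      then have "R k v = T s k" using v 4 k4 by (simp add: R_simps tr_up sw_def)
      then show ?thesis using tail_edge[OF 4 k4, of s] v 2 by (simp only: insert_commute)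
    next
      case 3
      then have "R k v = T s (e + 5)" using v 4 by (simp add: R_simps tr_def sw_def)
      then show ?thesis using tail_last_edge[of s] v 3 by (simp only:)
    next
      case k: 4
      then have "R k v = T s (e + 4)" using v 4 by (simp add: R_simps tr_def sw_def transpose_def)
      then show ?thesis using tail_last_edge[of s] v k by (simp only: insert_commute)
    next
      case 5
      then have "R k v = T (\<not> s) j" using v 4 by (auto simp: R_simps tr_def sw_def transpose_def)
      then show ?thesis using side_edge[of j s] v 5 by (simp only:)
    qed
  qed
qed

lemma rho_eq:
  assumes "k < rk"
  shows "thm410_rho N rk k = \<phi> (R k)"
  unfolding thm410_rho_def
proof (rule lgraph_perm_eqI)
  fix x y :: nat assume ne: "x \<noteq> y"
  have k: "k < e + 4" using assms by (simp add: rk_def)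
  have perm: "\<phi> (R k) permutes {1..M + 2 * e + 6}" by (rule \<phi>_permutes[OF R_permutes[OF k]])
  show "({x, y}, k) \<in> thm410_edges N rk \<longleftrightarrow> \<phi> (R k) x = y"
  proof
    assume "({x, y}, k) \<in> thm410_edges N rk"
    then obtain v where v: "v \<in> V" "{x, y} = {enc v, enc (R k v)}" using edge_sound by metis
    have "R k v \<in> V" by (rule R_in_V[OF k v(1)])
    then show "\<phi> (R k) x = y" using v \<phi>_apply R_R[of k v] by (metis doubleton_eq_iff)
  next
    assume y: "\<phi> (R k) x = y"
    then have "x \<in> {1..M + 2 * e + 6}" using ne perm permutes_not_in by metis
    then obtain v where v: "v \<in> V" "x = enc v" using enc_bij by (metis bij_betw_imp_surj_on imageE)
    then have "y = enc (R k v)" using y \<phi>_apply by simp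
    moreover from this have "R k v \<noteq> v" using ne v by auto
    ultimately show "({x, y}, k) \<in> thm410_edges N rk" using edge_complete[OF assms v(1)] v by simp
  qed
qed

section \<open>The generated groups inside the alternating group\<close>

lemma generate_eq:
  assumes J: "J \<subseteq> {..<rk}"
  shows "generate (sym_group N) (thm410_rho N rk ` J) = \<phi> ` gp (R ` J)"
proof -
  have J4: "J \<subseteq> {..<e + 4}" using J by (simp add: rk_def)
  have perm: "g permutes V" if "g \<in> gp (R ` J)" for g using gp_R_even[OF that J4] by simp
  have rho: "thm410_rho N rk k = \<phi> (R k)" if "k \<in> J" for k using rho_eq that J by auto
  have carrier: "\<phi> g \<in> carrier (sym_group N)" if "g permutes V" for g
    using \<phi>_permutes[OF that] by (simp add: sym_group_carrier N_def)
  show ?thesis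
  proof
    show "generate (sym_group N) (thm410_rho N rk ` J) \<subseteq> \<phi> ` gp (R ` J)"
    proof
      fix x assume "x \<in> generate (sym_group N) (thm410_rho N rk ` J)"
      then show "x \<in> \<phi> ` gp (R ` J)"
      proof (induction rule: generate.induct)
        case one
        have "\<one>\<^bsub>sym_group N\<^esub> = \<phi> id" by (simp only: sym_group_one \<phi>_id)
        then show ?case using gp_id by blast
      next
        case (incl h)
        then show ?case using rho by (auto intro: gp_gen)
      next
        case (inv h)
        then obtain k where k: "k \<in> J" "h = \<phi> (R k)" using rho by auto
        have R: "R k permutes V" using k J4 R_permutes by auto
        have "h \<circ> h = \<phi> (R k \<circ> R k)" using \<phi>_comp[OF R] k by simp
        also have "R k \<circ> R k = id" by (simp add: fun_eq_iff R_R)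
        finally have "h \<circ> h = id" by (simp only: \<phi>_id)
        then have "inv' h = h" by (metis inv_unique_comp)
        then have "inv\<^bsub>sym_group N\<^esub> h = h" using carrier[OF R] k by simp
        then show ?case using k by (auto intro: gp_gen)
      next
        case (eng h1 h2)
        then obtain g1 g2 where g: "g1 \<in> gp (R ` J)" "g2 \<in> gp (R ` J)" "h1 = \<phi> g1" "h2 = \<phi> g2" by blast
        then have "h1 \<otimes>\<^bsub>sym_group N\<^esub> h2 = \<phi> (g1 \<circ> g2)"
          using \<phi>_comp[OF perm[OF g(2)], of g1] by (simp add: sym_group_mult)
        then show ?case using gp_comp[OF g(1,2)] by blast
      qed
    qed
    have "\<phi> g \<in> generate (sym_group N) (thm410_rho N rk ` J)" if "g \<in> gp (R ` J)" for g
      using that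
    proof (induction rule: gp.induct)
      case gp_id
      have "\<phi> id = \<one>\<^bsub>sym_group N\<^esub>" by (simp only: sym_group_one \<phi>_id)
      then show ?case using generate.one by metis
    next
      case (gp_step s g)
      then obtain k where k: "k \<in> J" "s = R k" by auto
      have "\<phi> (s \<circ> g) = thm410_rho N rk k \<otimes>\<^bsub>sym_group N\<^esub> \<phi> g"
        using \<phi>_comp[OF perm[OF gp_step(2)], of s] k rho by (simp add: sym_group_mult)
      moreover have "thm410_rho N rk k \<in> generate (sym_group N) (thm410_rho N rk ` J)"
        using k by (auto intro: generate.incl)
      ultimately show ?case using gp_step.IH generate.eng by metis
    qed
    then show "\<phi> ` gp (R ` J) \<subseteq> generate (sym_group N) (thm410_rho N rk ` J)" by blast
  qed
qed

text \<open>The structures are equal and not merely isomorphic, so the remaining claims can be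
  proved for \<open>alt_group N\<close>.\<close>

lemma G_eq: "thm410_G N rk = alt_group N"
proof -
  have "generate (sym_group N) (thm410_rho N rk ` {..<rk}) = \<phi> ` {g. g permutes V \<and> evenperm g}"
    using generate_eq[of "{..<rk}"] gp_R_all by (simp add: rk_def)
  also have "\<dots> = {p. p permutes {1..N} \<and> evenperm p}"
  proof
    show "\<phi> ` {g. g permutes V \<and> evenperm g} \<subseteq> {p. p permutes {1..N} \<and> evenperm p}"
      using \<phi>_permutes \<phi>_even by (auto simp: N_def)
    show "{p. p permutes {1..N} \<and> evenperm p} \<subseteq> \<phi> ` {g. g permutes V \<and> evenperm g}"
    proof
      fix p assume p: "p \<in> {p. p permutes {1..N} \<and> evenperm p}"
      then obtain q where "q permutes V" "\<phi> q = p" using \<phi>_surj by (auto simp: N_def)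
      then show "p \<in> \<phi> ` {g. g permutes V \<and> evenperm g}" using p \<phi>_even by auto
    qed
  qed
  finally show ?thesis by (simp add: thm410_G_def alt_group_def)
qed

lemma alt_generate:
  assumes "J \<subseteq> {..<rk}"
  shows "generate (alt_group N) (thm410_rho N rk ` J) = \<phi> ` gp (R ` J)"
proof -
  have "thm410_rho N rk ` J \<subseteq> carrier (alt_group N)"
    using assms by (auto simp: G_eq[symmetric] thm410_G_def intro: generate.incl)
  then have "generate ((sym_group N)\<lparr>carrier := carrier (alt_group N)\<rparr>) (thm410_rho N rk ` J)
    = generate (sym_group N) (thm410_rho N rk ` J)"
    using group.generate_consistent[OF sym_group_is_group] alt_group_is_subgroup by blast
  then show ?thesis using generate_eq[OF assms] by (simp add: alt_group_def)
qed

lemma alt_pow: "x [^]\<^bsub>alt_group N\<^esub> (k :: nat) = x ^^ k"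
proof (induction k)
  case 0
  then show ?case by (simp add: nat_pow_def alt_group_one)
next
  case (Suc k)
  have "x [^]\<^bsub>alt_group N\<^esub> Suc k = x [^]\<^bsub>alt_group N\<^esub> k \<circ> x"
    by (simp add: nat_pow_def alt_group_mult)
  then show ?case by (simp only: Suc funpow_Suc_right)
qed

lemma rho_prod_pow:
  assumes "i < rk" "j < rk"
  shows "(thm410_rho N rk i \<otimes>\<^bsub>alt_group N\<^esub> thm410_rho N rk j) [^]\<^bsub>alt_group N\<^esub> (k :: nat) = \<one>\<^bsub>alt_group N\<^esub>
    \<longleftrightarrow> (R i \<circ> R j) ^^ k = id"
proof -
  have perm: "R i permutes V" "R j permutes V" using R_permutes assms by (auto simp: rk_def)
  then have ij: "R i \<circ> R j permutes V" by (intro permutes_compose)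
  have "thm410_rho N rk i \<otimes>\<^bsub>alt_group N\<^esub> thm410_rho N rk j = \<phi> (R i \<circ> R j)"
    using rho_eq assms \<phi>_comp[OF perm(2)] by (simp only: alt_group_mult)
  then have "(thm410_rho N rk i \<otimes>\<^bsub>alt_group N\<^esub> thm410_rho N rk j) [^]\<^bsub>alt_group N\<^esub> k = \<phi> ((R i \<circ> R j) ^^ k)"
    by (simp only: alt_pow \<phi>_funpow[OF ij])
  moreover have "\<phi> ((R i \<circ> R j) ^^ k) = \<phi> id \<longleftrightarrow> (R i \<circ> R j) ^^ k = id"
    by (rule \<phi>_eq_iff[OF permutes_funpow[OF ij] permutes_id])
  ultimately show ?thesis by (simp only: alt_group_one \<phi>_id)
qed

lemma alt_sggi: "sggi (alt_group N) rk (thm410_rho N rk)"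
  unfolding sggi_def
proof (intro conjI allI impI)
  show "group (alt_group N)" by (rule alt_group_is_group)
  show "generate (alt_group N) (thm410_rho N rk ` {..<rk}) = carrier (alt_group N)"
    using alt_generate[of "{..<rk}"] generate_eq[of "{..<rk}"] by (simp add: G_eq[symmetric] thm410_G_def)
next
  fix i assume i: "i < rk"
  then have R: "R i permutes V" "R i \<noteq> id" using R_permutes R_nontrivial by (auto simp: rk_def)
  show "thm410_rho N rk i \<in> carrier (alt_group N)"
    using i by (auto simp: G_eq[symmetric] thm410_G_def intro: generate.incl)
  show "thm410_rho N rk i \<noteq> \<one>\<^bsub>alt_group N\<^esub>"
    using \<phi>_eq_iff[OF R(1) permutes_id] R(2) rho_eq[OF i] by (simp only: alt_group_one \<phi>_id) simp
  have "R i \<circ> R i = id" by (simp add: fun_eq_iff R_R)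
  then show "thm410_rho N rk i \<otimes>\<^bsub>alt_group N\<^esub> thm410_rho N rk i = \<one>\<^bsub>alt_group N\<^esub>"
    using rho_eq[OF i] \<phi>_comp[OF R(1), of "R i"] by (simp only: alt_group_mult alt_group_one \<phi>_id)
next
  fix i j assume ij: "i < rk" "j < rk" "i + 2 \<le> j \<or> j + 2 \<le> i"
  have "R i \<circ> R j = R j \<circ> R i" using R_comm[of i j] R_comm[of j i] ij by (auto simp: rk_def)
  then have "R i (R j (R i (R j p))) = p" for p using R_R by (metis comp_apply)
  then have "(R i \<circ> R j) ^^ 2 = id" by (simp add: numeral_2_eq_2 fun_eq_iff)
  then show "(thm410_rho N rk i \<otimes>\<^bsub>alt_group N\<^esub> thm410_rho N rk j) [^]\<^bsub>alt_group N\<^esub> (2 :: nat) = \<one>\<^bsub>alt_group N\<^esub>"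
    using rho_prod_pow ij by blast
qed

lemma alt_intersection_property: "intersection_property (alt_group N) rk (thm410_rho N rk)"
  unfolding intersection_property_def
proof (intro allI impI)
  fix J K assume JK: "J \<subseteq> {..<rk}" "K \<subseteq> {..<rk}"
  then have J4: "J \<subseteq> {..<e + 4}" and K4: "K \<subseteq> {..<e + 4}" by (simp_all add: rk_def)
  have inj: "inj_on \<phi> (gp (R ` J) \<union> gp (R ` K))"
    using gp_R_even[OF _ J4] gp_R_even[OF _ K4] \<phi>_eq_iff by (intro inj_onI) blast
  have "\<phi> ` gp (R ` J) \<inter> \<phi> ` gp (R ` K) = \<phi> ` (gp (R ` J) \<inter> gp (R ` K))"
    by (rule inj_on_image_Int[OF inj, symmetric]) auto
  also have "\<dots> = \<phi> ` gp (R ` (J \<inter> K))" by (simp only: R_intersection[OF J4 K4])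
  finally show "generate (alt_group N) (thm410_rho N rk ` J) \<inter> generate (alt_group N) (thm410_rho N rk ` K)
    = generate (alt_group N) (thm410_rho N rk ` (J \<inter> K))"
    using alt_generate JK alt_generate[of "J \<inter> K"] by (simp add: le_infI1)
qed

lemma alt_ord:
  assumes i: "Suc i < rk" and d: "\<And>k. (R i \<circ> R (Suc i)) ^^ k = id \<longleftrightarrow> d dvd k"
  shows "group.ord (alt_group N) (thm410_rho N rk i \<otimes>\<^bsub>alt_group N\<^esub> thm410_rho N rk (Suc i)) = d"
proof -
  have "thm410_rho N rk i \<otimes>\<^bsub>alt_group N\<^esub> thm410_rho N rk (Suc i) \<in> carrier (alt_group N)"
    using alt_sggi i unfolding sggi_def by (meson Suc_lessD group.is_monoid monoid.m_closed)
  then show ?thesis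
    using group.ord_unique[OF alt_group_is_group] rho_prod_pow[OF Suc_lessD[OF i] i] d by blast
qed

lemma alt_schlafli:
  "schlafli_type (alt_group N) rk (thm410_rho N rk) = [M, 12, 6] @ replicate (e - 4) 3 @ [6, 6, 6, 4]"
proof -
  let ?o = "\<lambda>i. group.ord (alt_group N) (thm410_rho N rk i \<otimes>\<^bsub>alt_group N\<^esub> thm410_rho N rk (Suc i))"
  \<comment> \<open>The entries 3 stop before e - 1: from there on each product involves
    \<open>R e\<close> or \<open>R (e + 2)\<close>.\<close>
  obtain k where k: "Suc k = e" using e by (metis not_numeral_le_zero old.nat.exhaust)
  have o0: "?o 0 = M" by (rule alt_ord) (use order_0 in \<open>simp_all add: rk_def\<close>)
  have o1: "?o 1 = 12" by (rule alt_ord) (use order_1 in \<open>simp_all add: rk_def numeral_2_eq_2\<close>)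
  have o2: "?o 2 = 6" by (rule alt_ord) (use order_2 in \<open>simp_all add: rk_def numeral_3_eq_3 numeral_2_eq_2\<close>)
  have op: "?o i = 3" if "3 \<le> i" "i < k" for i
    by (rule alt_ord) (use order_plain[of i] that k in \<open>simp_all add: rk_def\<close>)
  have ok: "?o k = 6" by (rule alt_ord) (use order_e_minus_1[OF k] k in \<open>simp_all add: rk_def\<close>)
  have oe: "?o e = 6" by (rule alt_ord) (use order_e in \<open>simp_all add: rk_def\<close>)
  have oe1: "?o (e + 1) = 6" by (rule alt_ord) (use order_e_plus_1 in \<open>simp_all add: rk_def\<close>)
  have oe2: "?o (e + 2) = 4" by (rule alt_ord) (use order_e_plus_2 in \<open>simp_all add: rk_def numeral_3_eq_3\<close>)
  have "3 \<le> k" using k e by simp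
  then have "[0..<k + 4] = [0..<3] @ [3..<k] @ [k..<k + 4]"
    using upt_add_eq_append[of 0 3 "k - 3"] upt_add_eq_append[of 0 k 4] by simp
  moreover have "rk - 1 = k + 4" using k by (simp add: rk_def)
  ultimately have "[0..<rk - 1] = [0..<3] @ [3..<k] @ [k..<k + 4]" by simp
  also have "[0..<3] = [0, 1, 2 :: nat]" by (simp add: upt_rec)
  also have "[k..<k + 4] = [k, e, e + 1, e + 2]" using k by (simp add: upt_rec)
  finally have "schlafli_type (alt_group N) rk (thm410_rho N rk) = map ?o ([0, 1, 2] @ [3..<k] @ [k, e, e + 1, e + 2])"
    unfolding schlafli_type_def by (simp only:)
  also have "\<dots> = [?o 0, ?o 1, ?o 2] @ map ?o [3..<k] @ [?o k, ?o e, ?o (e + 1), ?o (e + 2)]"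
    by (simp only: map_append list.map)
  also have "map ?o [3..<k] = map (\<lambda>_. 3) [3..<k]" by (rule map_cong) (use op in auto)
  also have "\<dots> = replicate (e - 4) 3" using k by (auto simp: map_replicate_const)
  finally show ?thesis by (simp only: o0 o1 o2 ok oe oe1 oe2)
qed

end

theorem theorem4p10:
  fixes n r :: nat
  assumes "n \<ge> 19" and "n mod 4 = 3"
    and "even r" and "8 \<le> r" and "2 * r < n - 3"
  shows "thm410_G n r \<cong> alt_group n
    \<and> string_C_group (thm410_G n r) r (thm410_rho n r)
    \<and> schlafli_type (thm410_G n r) r (thm410_rho n r)
        = [n - 2 * (r - 1), 12, 6] @ replicate (r - 8) 3 @ [6, 6, 6, 4]"
proof -
  define M where "M = n - 2 * r + 2"
  define e where "e = r - 4"
  obtain q where q: "r = 2 * q" using assms(3) by (elim evenE)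
  have n: "n = M + 2 * r - 2" "2 * r < n" using assms by (auto simp: M_def)
  define t where "t = n div 4"
  have t: "n = 4 * t + 3" using assms(2) div_mult_mod_eq[of n 4] by (simp add: t_def)
  \<comment> \<open>The bound 2 r < n - 3 becomes \<open>q < t\<close>, which gives
    \<open>9 \<le> M\<close>.\<close>
  then have "M = 4 * (t - q) + 5" "q < t" using assms(5) q by (auto simp: M_def)
  then have "M mod 4 = 1" "9 \<le> M" by auto
  then interpret pt_graph M e
    by unfold_locales (use assms in \<open>auto simp: e_def\<close>)
  have r: "r = e + 4" using assms(4) by (simp add: e_def)
  have eqs: "N = n" "rk = r" unfolding N_def rk_def using n r by simp_all
  have "n - 2 * (r - 1) = M" "r - 8 = e - 4" using n r assms(4) by simp_all
  then show ?thesis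
    using alt_sggi alt_intersection_property alt_schlafli G_eq
    unfolding eqs string_C_group_def by simp
qed

end
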